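(* For all $q\in\mathbf{C}$ with $|q|<1$, \begin{align*} 32\,\widetilde{\Phi}_{1,2}&=\mathcal{P}^{2}-\mathcal{Q},\\ 16\,\widetilde{\Phi}_{1,4}&=-\mathcal{P}\mathcal{Q}+\mathcal{R},\\ 16\,\widetilde{\Phi}_{1,6}&=3\mathcal{P}\mathcal{R}-\mathcal{Q}^{2}-2\mathcal{E}\mathcal{R},\\ 64\,\widetilde{\Phi}_{2,3}&=\mathcal{P}^{3}-3\mathcal{P}\mathcal{Q}+2\mathcal{R},\\ 64\,\widetilde{\Phi}_{2,5}&=-5\mathcal{P}^{2}\mathcal{Q}-\mathcal{Q}^{2}+10\mathcal{P}\mathcal{R}-4\mathcal{E}\mathcal{R},\\ 64\,\widetilde{\Phi}_{2,7}&=21\mathcal{P}^{2}\mathcal{R}+13\mathcal{Q}\mathcal{R}-14\mathcal{P}\mathcal{Q}^{2}-28\mathcal{P}\mathcal{E}\mathcal{R}+8\mathcal{E}^{2}\mathcal{R}. \end{align*} Moreover, if $r,s$ are integers with $s\ge r\ge 0$ and $r+s$ odd, then $$\widetilde{\Phi}_{r,s}=\sum_{\substack{i,j,k,l\ge 0\\ 2i+2j+4k+6l=r+s+1}}K_{ijkl}\,\mathcal{P}^{i}\mathcal{E}^{j}\mathcal{Q}^{k}\mathcal{R}^{l}$$ for some rational numbers $K_{ijkl}$.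
   Context: Throughout $q\in\mathbf{C}$ with $|q|<1$. For $n\ge1$ let $\widetilde{\sigma}_{s}(n)=\sum_{d\mid n}(-1)^{d-1}d^{s}$ and $\widehat{\sigma}_{s}(n)=\sum_{d\mid n}(-1)^{n/d-1}d^{s}$, with $\widetilde{\sigma}=\widetilde{\sigma}_{1}$, $\widehat{\sigma}=\widehat{\sigma}_{1}$, and set $\widetilde{\sigma}(0)=\tfrac18$, $\widehat{\sigma}(0)=\tfrac1{24}$, $\widetilde{\sigma}_{3}(0)=-\tfrac1{16}$, $\widetilde{\sigma}_{5}(0)=\tfrac18$. Define $$\mathcal{P}(q)=\sum_{n=0}^{\infty}8\widetilde{\sigma}(n)q^{n},\quad \mathcal{E}(q)=\sum_{n=0}^{\infty}24\widehat{\sigma}(n)q^{n},\quad \mathcal{Q}(q)=\sum_{n=0}^{\infty}(-16\widetilde{\sigma}_{3}(n))q^{n},\quad \mathcal{R}(q)=\sum_{n=0}^{\infty}8\widetilde{\sigma}_{5}(n)q^{n}.$$ For integers $s\ge r\ge 0$ define $$\widetilde{\Phi}_{r,s}(q)=\left(q\frac{d}{dq}\right)^{r}\sum_{n=1}^{\infty}\widetilde{\sigma}_{s-r}(n)q^{n}=\sum_{n=1}^{\infty}n^{r}\,\widetilde{\sigma}_{s-r}(n)q^{n}.$$ In the claim, all functions are evaluated at $q$.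
   Formalization: For r = 0 the printed expansion is false (e.g. r=0, s=1: constant term of the series is 0), so there it is proved for c + Φ̃_{0,s} with some rational constant c; for all s ≥ r ≥ 1 with r+s odd, and for the six identities, the claim is as printed. *)

theory Defs
  imports "HOL-Complex_Analysis.Complex_Analysis"
begin

text \<open>
  At \<open>n = 0\<close> only the values for \<open>s = 1, 3, 5\<close> are part of the theory;
  the value \<open>0\<close> for the other \<open>s\<close> is a dummy that is never used.
\<close>

definition sigma_tilde :: "nat \<Rightarrow> nat \<Rightarrow> complex" where
  "sigma_tilde s n =
     (if n = 0 then
        (if s = 1 then 1/8 else if s = 3 then - 1/16 else if s = 5 then 1/8 else 0)
      else (\<Sum>d | d dvd n. (- 1) ^ (d - 1) * of_nat d ^ s))"

definition sigma_hat :: "nat \<Rightarrow> complex" where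
  "sigma_hat n =
     (if n = 0 then 1/24 else (\<Sum>d | d dvd n. (- 1) ^ (n div d - 1) * of_nat d))"

definition P_fun :: "complex \<Rightarrow> complex" where
  "P_fun q = (\<Sum>n. 8 * sigma_tilde 1 n * q ^ n)"

definition E_fun :: "complex \<Rightarrow> complex" where
  "E_fun q = (\<Sum>n. 24 * sigma_hat n * q ^ n)"

definition Q_fun :: "complex \<Rightarrow> complex" where
  "Q_fun q = (\<Sum>n. (- 16 * sigma_tilde 3 n) * q ^ n)"

definition R_fun :: "complex \<Rightarrow> complex" where
  "R_fun q = (\<Sum>n. 8 * sigma_tilde 5 n * q ^ n)"

definition q_deriv :: "(complex \<Rightarrow> complex) \<Rightarrow> complex \<Rightarrow> complex" where
  "q_deriv f = (\<lambda>q. q * deriv f q)"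

text \<open>
  The series start at \<open>n = 1\<close>, hence the index shift.  The definition is meant for
  \<open>r \<le> s\<close> and \<open>norm q < 1\<close>; that it agrees there with the termwise differentiated
  series is lemma \<open>Phi_tilde_eq\<close> below.
\<close>

definition Phi_tilde :: "nat \<Rightarrow> nat \<Rightarrow> complex \<Rightarrow> complex" where
  "Phi_tilde r s =
     (q_deriv ^^ r) (\<lambda>q. \<Sum>n. sigma_tilde (s - r) (Suc n) * q ^ Suc n)"

lemma norm_divisor_sum_le:
  fixes c :: "nat \<Rightarrow> complex"
  assumes "n > 0" and c: "\<And>d. norm (c d) = 1"
  shows "norm (\<Sum>d | d dvd n. c d * of_nat d ^ s) \<le> real n ^ Suc s"
proof -
  have sub: "{d. d dvd n} \<subseteq> {1..n}"
    using assms(1) by (auto dest: dvd_imp_le intro: Suc_leI dvd_pos_nat)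
  have "norm (\<Sum>d | d dvd n. c d * of_nat d ^ s) \<le> (\<Sum>d | d dvd n. real n ^ s)"
    using sub by (intro sum_norm_le) (auto simp: norm_mult norm_power c intro!: power_mono)
  also have "\<dots> = real (card {d. d dvd n}) * real n ^ s"
    by simp
  also have "\<dots> \<le> real n * real n ^ s"
    using card_mono[OF _ sub] by (intro mult_right_mono) auto
  finally show ?thesis by simp
qed

lemma norm_sigma_tilde_le: "n > 0 \<Longrightarrow> norm (sigma_tilde s n) \<le> real n ^ Suc s"
  using norm_divisor_sum_le[of n "\<lambda>d. (- 1) ^ (d - 1)" s]
  by (simp add: sigma_tilde_def norm_power)

lemma norm_sigma_hat_le: "n > 0 \<Longrightarrow> norm (sigma_hat n) \<le> real n ^ 2"
  using norm_divisor_sum_le[of n "\<lambda>d. (- 1) ^ (n div d - 1)" 1]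
  by (simp add: sigma_hat_def norm_power power2_eq_square)

lemma q_deriv_power_series_step:
  fixes a :: "nat \<Rightarrow> complex" and q :: complex
  assumes a: "\<And>q. norm q < 1 \<Longrightarrow> summable (\<lambda>n. a n * q ^ n)" and q: "norm q < 1"
  shows "(\<lambda>n. (of_nat n * a n) * q ^ n) sums (q * deriv (\<lambda>q. \<Sum>n. a n * q ^ n) q)"
proof -
  have "((\<lambda>q. \<Sum>n. a n * q ^ n) has_field_derivative (\<Sum>n. diffs a n * q ^ n)) (at q)"
    using termdiffs_strong'[of 1 a q] a q by auto
  hence "deriv (\<lambda>q. \<Sum>n. a n * q ^ n) q = (\<Sum>n. diffs a n * q ^ n)"
    by (rule DERIV_imp_deriv)
  moreover have "summable (\<lambda>n. diffs a n * q ^ n)"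
    using termdiff_converges[of q 1 a] a q by auto
  ultimately have "(\<lambda>n. diffs a n * q ^ n) sums deriv (\<lambda>q. \<Sum>n. a n * q ^ n) q"
    by (simp add: summable_sums)
  hence "(\<lambda>n. q * (diffs a n * q ^ n)) sums (q * deriv (\<lambda>q. \<Sum>n. a n * q ^ n) q)"
    by (rule sums_mult)
  hence "(\<lambda>n. (of_nat (Suc n) * a (Suc n)) * q ^ Suc n) sums
           (q * deriv (\<lambda>q. \<Sum>n. a n * q ^ n) q)"
    by (simp add: diffs_def mult_ac)
  thus ?thesis
    by (subst (asm) sums_Suc_iff) simp
qed

lemma q_deriv_cong:
  assumes "\<And>q. norm q < 1 \<Longrightarrow> f q = g q" and "norm q < 1"
  shows "q_deriv f q = q_deriv g q"
proof -
  have "eventually (\<lambda>z. z \<in> ball 0 1) (nhds q)"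
    using assms(2) by (intro eventually_nhds_in_open) auto
  hence "eventually (\<lambda>z. f z = g z) (nhds q)"
    by eventually_elim (use assms(1) in auto)
  thus ?thesis
    unfolding q_deriv_def by (simp cong: deriv_cong_ev)
qed

lemma q_deriv_funpow_power_series:
  fixes a :: "nat \<Rightarrow> complex" and q :: complex
  assumes a: "\<And>q. norm q < 1 \<Longrightarrow> summable (\<lambda>n. a n * q ^ n)" and q: "norm q < 1"
  shows "(\<lambda>n. (of_nat n ^ r * a n) * q ^ n) sums (q_deriv ^^ r) (\<lambda>q. \<Sum>n. a n * q ^ n) q"
  using q
proof (induction r arbitrary: q)
  case 0
  thus ?case using a by (simp add: summable_sums)
next
  case (Suc r)
  have "(\<lambda>n. (of_nat n * (of_nat n ^ r * a n)) * q ^ n) sums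
          (q_deriv (\<lambda>q. \<Sum>n. (of_nat n ^ r * a n) * q ^ n) q)"
    unfolding q_deriv_def using Suc sums_summable by (intro q_deriv_power_series_step) blast+
  also have "q_deriv (\<lambda>q. \<Sum>n. (of_nat n ^ r * a n) * q ^ n) q =
               q_deriv ((q_deriv ^^ r) (\<lambda>q. \<Sum>n. a n * q ^ n)) q"
    using Suc by (intro q_deriv_cong) (auto simp: sums_iff)
  finally show ?case
    by (simp add: mult_ac)
qed

lemma summable_of_poly_bound:
  fixes a :: "nat \<Rightarrow> complex" and q :: complex
  assumes q: "norm q < 1" and a: "\<And>n. n > 0 \<Longrightarrow> norm (a n) \<le> real n ^ m"
  shows "summable (\<lambda>n. a n * q ^ n)"
proof -
  have "summable (\<lambda>n. (of_nat n ^ m * 1) * complex_of_real (norm q) ^ n)"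
    using q_deriv_funpow_power_series[of "\<lambda>_. 1" "of_real (norm q)" m] q
    by (auto simp: sums_iff intro: summable_geometric)
  hence "summable (\<lambda>n. complex_of_real (real n ^ m * norm q ^ n))"
    by simp
  hence "summable (\<lambda>n. real n ^ m * norm q ^ n)"
    by (simp only: summable_of_real_iff)
  thus ?thesis
    using a by (elim summable_comparison_test'[where N = 1])
               (auto simp: norm_mult norm_power intro!: mult_right_mono)
qed

lemma summable_sigma_tilde: "norm q < 1 \<Longrightarrow> summable (\<lambda>n. sigma_tilde s n * q ^ n)"
  by (rule summable_of_poly_bound[OF _ norm_sigma_tilde_le])

lemma summable_sigma_hat: "norm q < 1 \<Longrightarrow> summable (\<lambda>n. sigma_hat n * q ^ n)"
  by (rule summable_of_poly_bound[OF _ norm_sigma_hat_le])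

lemma Phi_tilde_sums:
  assumes "norm q < 1"
  shows "(\<lambda>n. of_nat (Suc n) ^ r * sigma_tilde (s - r) (Suc n) * q ^ Suc n) sums
           Phi_tilde r s q"
proof -
  define a where "a = (\<lambda>n. if n = 0 then 0 else sigma_tilde (s - r) n)"
  have sm: "summable (\<lambda>n. a n * q ^ n)" if "norm q < 1" for q
    by (rule summable_of_poly_bound[OF that, where m = "Suc (s - r)"])
       (use norm_sigma_tilde_le in \<open>auto simp: a_def\<close>)
  have eq: "(\<Sum>n. a n * q ^ n) = (\<Sum>n. sigma_tilde (s - r) (Suc n) * q ^ Suc n)"
    if "norm q < 1" for q
    using suminf_split_head[OF sm[OF that]] by (simp add: a_def)
  have funpow: "(q_deriv ^^ k) (\<lambda>q. \<Sum>n. a n * q ^ n) q =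
           (q_deriv ^^ k) (\<lambda>q. \<Sum>n. sigma_tilde (s - r) (Suc n) * q ^ Suc n) q"
    if "norm q < 1" for k q
    using that
  proof (induction k arbitrary: q)
    case 0
    thus ?case using eq by simp
  next
    case (Suc k)
    thus ?case by (auto intro: q_deriv_cong)
  qed
  have "(\<lambda>n. (of_nat n ^ r * a n) * q ^ n) sums Phi_tilde r s q"
    using q_deriv_funpow_power_series[OF sm assms, of r] funpow[OF assms, of r]
    by (simp add: Phi_tilde_def)
  hence "(\<lambda>n. (of_nat (Suc n) ^ r * a (Suc n)) * q ^ Suc n) sums Phi_tilde r s q"
    by (subst sums_Suc_iff) (simp add: a_def)
  thus ?thesis
    by (simp add: a_def)
qed

lemma Phi_tilde_eq:
  assumes "norm q < 1"
  shows "Phi_tilde r s q =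
           (\<Sum>n. of_nat (Suc n) ^ r * sigma_tilde (s - r) (Suc n) * q ^ Suc n)"
  using Phi_tilde_sums[OF assms] by (simp add: sums_iff)

end

(*
  Write x = e^t. The Lambert series U = 1/(2 + 2 cosh t) + 2 sum (-1)^(a-1) a cosh(a t) q^(a x)
  (over a, x > 0) is, up to sign and an additive constant, a Weierstrass function shifted by a half
  period, so it satisfies D^2 U + 6 U^2 = E2 U - (1/2) q dE2/dq with D = d/dt. Its Taylor coefficients
  in t are P/4, -Q/16, R/96, ... and in general a rational constant plus a multiple of Phi_{0,s};
  comparing coefficients gives R = E Q, a formula for q dE2/dq where E2 = 3 P - 2 E, and
  recursively an isobaric polynomial for every Phi_{0,s} + c.

  Both this differential equation and the two derivative formulas 4 q dP/dq = P^2 - Q and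
  q dQ/dq = P Q - R are proved coefficientwise in the ring of formal power series. The coefficient
  of q^n in a product of two Lambert series is a sum over the positive solutions of a x + b y = n,
  and these sums are evaluated with the Euclidean step (a, b, x, y) -> (a + b, b, x, y - x),
  which maps the solutions with x < y onto those with b < a. The remaining finite sums over a < d
  with d | n are a Fejer-type kernel identity for cosh and two alternating power sums.
*)
theory Submission
  imports Defs
begin

unbundle no vec_syntax

subsection \<open>Sums over the solutions of \<open>a x + b y = n\<close>\<close>

definition quads :: "nat \<Rightarrow> (nat \<times> nat \<times> nat \<times> nat) set" where
  "quads n = {(a, b, x, y). 0 < a \<and> 0 < b \<and> 0 < x \<and> 0 < y \<and> a * x + b * y = n}"

text \<open>The condition sees the whole quadruple, the summand only \<open>a\<close> and
  \<open>b\<close>: coefficients of Lambert products depend on \<open>a\<close> and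
  \<open>b\<close>, while the case distinctions also compare \<open>x\<close> with
  \<open>y\<close>.\<close>

definition qsum :: "nat \<Rightarrow> (nat \<Rightarrow> nat \<Rightarrow> nat \<Rightarrow> nat \<Rightarrow> bool) \<Rightarrow>
    (nat \<Rightarrow> nat \<Rightarrow> 'c) \<Rightarrow> 'c :: comm_ring_1" where
  "qsum n C F = (\<Sum>(a, b, x, y) | (a, b, x, y) \<in> quads n \<and> C a b x y. F a b)"

lemma finite_quads [simp]: "finite (quads n)"
proof (rule finite_subset)
  show "quads n \<subseteq> {..n} \<times> {..n} \<times> {..n} \<times> {..n}"
  proof (rule subsetI, clarify)
    fix a b x y assume "(a, b, x, y) \<in> quads n"
    then have *: "0 < a" "0 < b" "0 < x" "0 < y" "a * x + b * y = n"
      by (auto simp: quads_def)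
    then have "a \<le> a * x" "x \<le> a * x" "b \<le> b * y" "y \<le> b * y" by auto
    with *(5) have "a \<le> n" "b \<le> n" "x \<le> n" "y \<le> n" by linarith+
    then show "a \<in> {..n} \<and> (b, x, y) \<in> {..n} \<times> {..n} \<times> {..n}" by auto
  qed
qed auto

lemma finite_quads_filter [simp]: "finite {(a, b, x, y). (a, b, x, y) \<in> quads n \<and> C a b x y}"
  by (rule finite_subset[OF _ finite_quads[of n]]) auto

lemma qsum_eqI:
  assumes "bij_betw \<phi> {(a, b, x, y). (a, b, x, y) \<in> quads n \<and> C a b x y}
      {(a, b, x, y). (a, b, x, y) \<in> quads n \<and> C' a b x y}"
    and "\<And>a b x y. (a, b, x, y) \<in> quads n \<Longrightarrow> C a b x y \<Longrightarrow>
      (case \<phi> (a, b, x, y) of (a', b', x', y') \<Rightarrow> F' a' b') = F a b"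
  shows "qsum n C F = qsum n C' F'"
  unfolding qsum_def
  by (subst sum.reindex_bij_betw[OF assms(1), symmetric]) (auto intro!: sum.cong simp: assms(2))

lemma qsum_cong:
  assumes "\<And>a b x y. (a, b, x, y) \<in> quads n \<Longrightarrow> C a b x y \<longleftrightarrow> C' a b x y"
    and "\<And>a b x y. (a, b, x, y) \<in> quads n \<Longrightarrow> C a b x y \<Longrightarrow> F a b = F' a b"
  shows "qsum n C F = qsum n C' F'"
  unfolding qsum_def using assms by (intro sum.cong) auto

lemma qsum_swap: "qsum n C F = qsum n (\<lambda>a b x y. C b a y x) (\<lambda>a b. F b a)"
  by (rule qsum_eqI[where \<phi> = "\<lambda>(a, b, x, y). (b, a, y, x)"],
      rule bij_betw_byWitness[where f' = "\<lambda>(a, b, x, y). (b, a, y, x)"])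
     (auto simp: quads_def add.commute)

text \<open>Since \<open>a x + b y = (a + b) x + b (y - x)\<close>, the Euclidean step stays among
  the solutions; \<open>x < y\<close> keeps its last entry positive, and \<open>b < a\<close> does
  the same for the first entry on the way back.\<close>

lemma qsum_euclid:
  "qsum n (\<lambda>a b x y. x < y) (\<lambda>a b. F (a + b) b) = qsum n (\<lambda>a b x y. b < a) F"
proof -
  have 1: "(a + b, b, x, y - x) \<in> quads n" if "(a, b, x, y) \<in> quads n" "x < y" for a b x y
  proof -
    obtain z where "y = x + z" using \<open>x < y\<close> less_imp_add_positive by blast
    then show ?thesis using that by (simp add: quads_def algebra_simps)
  qed
  have 2: "(a - b, b, x, x + y) \<in> quads n" if "(a, b, x, y) \<in> quads n" "b < a" for a b x y
  proof -
    obtain c where "a = b + c" using \<open>b < a\<close> less_imp_add_positive by blast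
    then show ?thesis using that by (simp add: quads_def algebra_simps)
  qed
  have pos: "0 < a" "0 < b" "0 < x" "0 < y" if "(a, b, x, y) \<in> quads n" for a b x y
    using that by (simp_all add: quads_def)
  show ?thesis
    by (rule qsum_eqI[where \<phi> = "\<lambda>(a, b, x, y). (a + b, b, x, y - x)"],
        rule bij_betw_byWitness[where f' = "\<lambda>(a, b, x, y). (a - b, b, x, x + y)"])
       (auto simp: 1 2 pos)
qed

lemma qsum_add: "qsum n C (\<lambda>a b. F a b + G a b) = qsum n C F + qsum n C G"
  and qsum_diff: "qsum n C (\<lambda>a b. F a b - G a b) = qsum n C F - qsum n C G"
  and qsum_uminus: "qsum n C (\<lambda>a b. - F a b) = - qsum n C F"
  and qsum_mult: "qsum n C (\<lambda>a b. c * F a b) = c * qsum n C F"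
  by (simp_all add: qsum_def sum.distrib sum_subtractf sum_negf sum_distrib_left case_prod_beta)

lemma qsum_split: "qsum n C F = qsum n (\<lambda>a b x y. C a b x y \<and> B a b x y) F +
    qsum n (\<lambda>a b x y. C a b x y \<and> \<not> B a b x y) F"
  unfolding qsum_def
  by (subst sum.union_disjoint[symmetric]) (auto intro!: sum.cong)

lemma qsum_split_three:
  fixes f g :: "nat \<Rightarrow> nat \<Rightarrow> nat \<Rightarrow> nat \<Rightarrow> nat"
  shows "qsum n (\<lambda>_ _ _ _. True) F = qsum n (\<lambda>a b x y. f a b x y < g a b x y) F +
    qsum n (\<lambda>a b x y. f a b x y = g a b x y) F + qsum n (\<lambda>a b x y. g a b x y < f a b x y) F"
proof -
  have "qsum n (\<lambda>_ _ _ _. True) F = qsum n (\<lambda>a b x y. f a b x y < g a b x y) F +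
      qsum n (\<lambda>a b x y. \<not> f a b x y < g a b x y) F"
    using qsum_split[of n "\<lambda>_ _ _ _. True" F "\<lambda>a b x y. f a b x y < g a b x y"] by simp
  also have "qsum n (\<lambda>a b x y. \<not> f a b x y < g a b x y) F =
      qsum n (\<lambda>a b x y. f a b x y = g a b x y) F + qsum n (\<lambda>a b x y. g a b x y < f a b x y) F"
    by (subst qsum_split[where B = "\<lambda>a b x y. f a b x y = g a b x y"])
       (intro arg_cong2[where f = "(+)"] qsum_cong; auto)
  finally show ?thesis by (simp add: add.assoc)
qed

text \<open>With \<open>a = b = d\<close> the equation reads \<open>d (x + y) = n\<close>, and
  \<open>n div d\<close> splits into two positive parts in \<open>n div d - 1\<close> ways.\<close>

lemma qsum_diag_ab:
  assumes "n > 0"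
  shows "qsum n (\<lambda>a b x y. a = b) F = (\<Sum>d | d dvd n. of_nat (n div d - 1) * F d d)"
proof -
  have *: "d * x + d * (n div d - x) = n" if "d dvd n" "x < n div d" for d x
    using that by (metis add_mult_distrib2 dvd_mult_div_cancel le_add_diff_inverse less_imp_le_nat)
  have "qsum n (\<lambda>a b x y. a = b) F =
      (\<Sum>(d, x) \<in> (SIGMA d : {d. d dvd n}. {1..<n div d}). F d d)"
    unfolding qsum_def
    by (rule sum.reindex_bij_witness[where
          i = "\<lambda>(d, x). (d, d, x, n div d - x)" and j = "\<lambda>(a, b, x, y). (a, x)"])
       (use assms in \<open>auto simp: quads_def * simp flip: distrib_left\<close>)
  also have "\<dots> = (\<Sum>d | d dvd n. \<Sum>x \<in> {1..<n div d}. F d d)"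
    using assms by (subst sum.Sigma) auto
  finally show ?thesis by simp
qed

text \<open>With \<open>x = y\<close> the equation reads \<open>(a + b) x = n\<close>, so
  \<open>d = a + b\<close> is a divisor of \<open>n\<close> and determines \<open>x\<close>.\<close>

lemma qsum_diag_xy:
  assumes "n > 0"
  shows "qsum n (\<lambda>a b x y. x = y) F = (\<Sum>d | d dvd n. \<Sum>a \<in> {1..<d}. F a (d - a))"
proof -
  have "qsum n (\<lambda>a b x y. x = y) F =
      (\<Sum>(d, a) \<in> (SIGMA d : {d. d dvd n}. {1..<d}). F a (d - a))"
    unfolding qsum_def
    by (rule sum.reindex_bij_witness[where
          i = "\<lambda>(d, a). (a, d - a, n div d, n div d)" and j = "\<lambda>(a, b, x, y). (a + b, a)"])
       (use assms in \<open>auto simp: quads_def simp flip: distrib_right\<close>)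
  then show ?thesis
    using assms by (subst sum.Sigma) auto
qed

abbreviation full :: "nat \<Rightarrow> nat \<Rightarrow> nat \<Rightarrow> nat \<Rightarrow> bool" where
  "full \<equiv> \<lambda>_ _ _ _. True"

lemma qsum_symmetric:
  assumes "\<And>a b. F a b = F b a"
  shows "qsum n full F = 2 * qsum n (\<lambda>a b x y. x < y) F + qsum n (\<lambda>a b x y. x = y) F"
    and "qsum n full F = 2 * qsum n (\<lambda>a b x y. b < a) F + qsum n (\<lambda>a b x y. a = b) F"
proof -
  have "qsum n (\<lambda>a b x y. y < x) F = qsum n (\<lambda>a b x y. x < y) F"
    by (subst qsum_swap) (use assms in simp)
  then show "qsum n full F = 2 * qsum n (\<lambda>a b x y. x < y) F + qsum n (\<lambda>a b x y. x = y) F"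
    using qsum_split_three[of n F "\<lambda>a b x y. x" "\<lambda>a b x y. y"] by simp
  have "qsum n (\<lambda>a b x y. a < b) F = qsum n (\<lambda>a b x y. b < a) F"
    by (subst qsum_swap) (use assms in simp)
  then show "qsum n full F = 2 * qsum n (\<lambda>a b x y. b < a) F + qsum n (\<lambda>a b x y. a = b) F"
    using qsum_split_three[of n F "\<lambda>a b x y. a" "\<lambda>a b x y. b"] by simp
qed

lemma qsum_euclid':
  "qsum n (\<lambda>a b x y. x < y) F = qsum n (\<lambda>a b x y. b < a) (\<lambda>a b. F (a - b) b)"
  using qsum_euclid[of n "\<lambda>a b. F (a - b) b"] by simp

text \<open>The first term is split by comparing \<open>x\<close> with \<open>y\<close>, the second
  by comparing \<open>a\<close> with \<open>b\<close>. The mirrored Euclidean step identifies the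
  part \<open>y < x\<close> of the former with the part \<open>a < b\<close> of the latter, so these
  cancel.\<close>

lemma qsum_telescope:
  "qsum n full (\<lambda>a b. G a (a + b) - G a b) =
    qsum n (\<lambda>a b x y. x < y) (\<lambda>a b. G a (a + b)) + qsum n (\<lambda>a b x y. x = y) (\<lambda>a b. G a (a + b))
    - qsum n (\<lambda>a b x y. b < a) G - qsum n (\<lambda>a b x y. a = b) G"
proof -
  have "qsum n (\<lambda>a b x y. y < x) (\<lambda>a b. G a (a + b)) = qsum n (\<lambda>a b x y. a < b) G"
    using qsum_euclid[of n "\<lambda>a b. G b a"]
    by (subst qsum_swap, subst (2) qsum_swap) (simp add: add.commute)
  then show ?thesis
    using qsum_split_three[of n "\<lambda>a b. G a (a + b)" "\<lambda>a b x y. x" "\<lambda>a b x y. y"]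
      qsum_split_three[of n G "\<lambda>a b x y. a" "\<lambda>a b x y. b"]
    by (simp add: qsum_diff)
qed

text \<open>The Euclidean step turns the \<open>x < y\<close> half of \<open>f (a + b)\<close> and
  the \<open>b < a\<close> half of \<open>f (a - b)\<close> into sums of \<open>f a\<close> alone,
  over \<open>b < a\<close> and over \<open>x < y\<close>. \<open>qsum_telescope\<close> for a
  \<open>G\<close> that ignores \<open>b\<close> compares these two sums, so that only the diagonals
  \<open>a = b\<close> and \<open>x = y\<close> survive.\<close>

lemma qsum_even_diff:
  fixes f :: "int \<Rightarrow> 'c :: comm_ring_1"
  assumes even: "\<And>m. f (- m) = f m" and n: "n > 0"
  shows "qsum n full (\<lambda>a b. f (int a - int b) - f (int a + int b)) =
    (\<Sum>d | d dvd n. of_nat (n div d - 1) * (2 * f (int d) + f 0) - of_nat (d - 1) * f (int d)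
      - 2 * (\<Sum>a \<in> {1..<d}. f (int a)))"
proof -
  have flip: "f (int a - int b) = f (int b - int a)" for a b
    using even[of "int a - int b"] by simp
  have plus: "qsum n full (\<lambda>a b. f (int a + int b)) =
      2 * qsum n (\<lambda>a b x y. b < a) (\<lambda>a b. f (int a)) +
      qsum n (\<lambda>a b x y. x = y) (\<lambda>a b. f (int a + int b))"
    using qsum_euclid[of n "\<lambda>a b. f (int a)"]
    by (subst qsum_symmetric(1)) (simp_all add: add.commute)
  have "qsum n (\<lambda>a b x y. x < y) (\<lambda>a b. f (int a)) =
      qsum n (\<lambda>a b x y. b < a) (\<lambda>a b. f (int a - int b))"
    by (subst qsum_euclid') (auto intro!: qsum_cong)
  then have minus: "qsum n full (\<lambda>a b. f (int a - int b)) =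
      2 * qsum n (\<lambda>a b x y. x < y) (\<lambda>a b. f (int a)) + qsum n (\<lambda>a b x y. a = b) (\<lambda>a b. f 0)"
    by (subst qsum_symmetric(2)) (auto intro: flip qsum_cong)
  have tele: "qsum n (\<lambda>a b x y. x < y) (\<lambda>a b. f (int a)) + qsum n (\<lambda>a b x y. x = y) (\<lambda>a b. f (int a)) =
      qsum n (\<lambda>a b x y. b < a) (\<lambda>a b. f (int a)) + qsum n (\<lambda>a b x y. a = b) (\<lambda>a b. f (int a))"
    using qsum_telescope[of n "\<lambda>a b. f (int a)"] by (simp add: qsum_def algebra_simps)
  have "qsum n full (\<lambda>a b. f (int a - int b) - f (int a + int b)) =
      2 * (qsum n (\<lambda>a b x y. x < y) (\<lambda>a b. f (int a)) - qsum n (\<lambda>a b x y. b < a) (\<lambda>a b. f (int a)))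
      + qsum n (\<lambda>a b x y. a = b) (\<lambda>a b. f 0) - qsum n (\<lambda>a b x y. x = y) (\<lambda>a b. f (int a + int b))"
    by (simp add: qsum_diff plus minus algebra_simps)
  also have "qsum n (\<lambda>a b x y. x < y) (\<lambda>a b. f (int a)) - qsum n (\<lambda>a b x y. b < a) (\<lambda>a b. f (int a)) =
      qsum n (\<lambda>a b x y. a = b) (\<lambda>a b. f (int a)) - qsum n (\<lambda>a b x y. x = y) (\<lambda>a b. f (int a))"
    using tele by (simp add: algebra_simps)
  also have "qsum n (\<lambda>a b x y. x = y) (\<lambda>a b. f (int a + int b)) =
      (\<Sum>d | d dvd n. of_nat (d - 1) * f (int d))"
    by (auto simp: qsum_diag_xy[OF n] of_nat_diff intro!: sum.cong)
  also have "2 * (qsum n (\<lambda>a b x y. a = b) (\<lambda>a b. f (int a)) - qsum n (\<lambda>a b x y. x = y) (\<lambda>a b. f (int a)))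
      + qsum n (\<lambda>a b x y. a = b) (\<lambda>a b. f 0) - (\<Sum>d | d dvd n. of_nat (d - 1) * f (int d)) =
      (\<Sum>d | d dvd n. of_nat (n div d - 1) * (2 * f (int d) + f 0) - of_nat (d - 1) * f (int d)
        - 2 * (\<Sum>a \<in> {1..<d}. f (int a)))"
    by (simp add: qsum_diag_xy[OF n] qsum_diag_ab[OF n] sum_subtractf sum.distrib sum_distrib_left
        algebra_simps)
  finally show ?thesis .
qed

text \<open>The method is that of \<open>qsum_even_diff\<close>, but the weight \<open>a b\<close>
  leaves a full sum in which \<open>f\<close> depends on \<open>a\<close> only; such a sum is again
  a coefficient of a product of two Lambert series.\<close>

lemma qsum_even_mult_sum:
  fixes f :: "int \<Rightarrow> 'c :: comm_ring_1"
  assumes even: "\<And>m. f (- m) = f m" and n: "n > 0"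
  shows "qsum n full (\<lambda>a b. of_nat (a * b) * (f (int a + int b) + f (int a - int b))) =
    4 * qsum n full (\<lambda>a b. of_nat (a * b) * f (int a)) +
    (\<Sum>d | d dvd n. of_nat (n div d - 1) * of_nat (d * d) * f 0
      + (\<Sum>a \<in> {1..<d}. of_nat (a * (d - a))) * f (int d)
      - 2 * (\<Sum>a \<in> {1..<d}. of_nat (d * (d - a)) * f (int a)))"
proof -
  \<comment> \<open>\<open>G\<close> is chosen such that
    \<open>- G (a + b) b = a b f (a + b)\<close>, such that the Euclidean step relates
    \<open>G a (a + b) = b (a + b) f a\<close> to \<open>a b f (a - b)\<close>, and such that
    \<open>G a (a + b) - G a b = 2 a b f a\<close>. It also vanishes for
    \<open>a = b\<close>.\<close>
  define G :: "nat \<Rightarrow> nat \<Rightarrow> 'c" where "G = (\<lambda>a b. of_nat b * (of_nat b - of_nat a) * f (int a))"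
  have flip: "f (int a - int b) = f (int b - int a)" for a b
    using even[of "int a - int b"] by simp
  have plus: "qsum n full (\<lambda>a b. of_nat (a * b) * f (int a + int b)) =
      - 2 * qsum n (\<lambda>a b x y. b < a) G +
      qsum n (\<lambda>a b x y. x = y) (\<lambda>a b. of_nat (a * b) * f (int a + int b))"
    using qsum_euclid[of n "\<lambda>a b. - G a b"]
    by (subst qsum_symmetric(1)) (simp_all add: add.commute mult_ac G_def qsum_uminus)
  have "qsum n (\<lambda>a b x y. x < y) (\<lambda>a b. G a (a + b)) =
      qsum n (\<lambda>a b x y. b < a) (\<lambda>a b. of_nat (a * b) * f (int a - int b))"
    by (subst qsum_euclid') (auto intro!: qsum_cong simp: G_def)
  then have minus: "qsum n full (\<lambda>a b. of_nat (a * b) * f (int a - int b)) =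
      2 * qsum n (\<lambda>a b x y. x < y) (\<lambda>a b. G a (a + b)) +
      qsum n (\<lambda>a b x y. a = b) (\<lambda>a b. of_nat (a * b) * f 0)"
    by (subst qsum_symmetric(2)) (auto intro: qsum_cong simp: flip mult_ac)
  have G_diff: "G a (a + b) - G a b = 2 * (of_nat (a * b) * f (int a))" for a b
    by (simp add: G_def algebra_simps)
  have G_diag: "qsum n (\<lambda>a b x y. a = b) G = 0"
    by (simp add: qsum_diag_ab[OF n] G_def)
  have tele: "2 * qsum n full (\<lambda>a b. of_nat (a * b) * f (int a)) =
      qsum n (\<lambda>a b x y. x < y) (\<lambda>a b. G a (a + b)) + qsum n (\<lambda>a b x y. x = y) (\<lambda>a b. G a (a + b))
      - qsum n (\<lambda>a b x y. b < a) G"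
    using qsum_telescope[of n G] unfolding G_diff G_diag qsum_mult by simp
  have "qsum n full (\<lambda>a b. of_nat (a * b) * (f (int a + int b) + f (int a - int b))) =
      2 * (qsum n (\<lambda>a b x y. x < y) (\<lambda>a b. G a (a + b)) - qsum n (\<lambda>a b x y. b < a) G) +
      (qsum n (\<lambda>a b x y. x = y) (\<lambda>a b. of_nat (a * b) * f (int a + int b)) +
       qsum n (\<lambda>a b x y. a = b) (\<lambda>a b. of_nat (a * b) * f 0))"
    unfolding distrib_left qsum_add plus minus by (simp add: algebra_simps)
  also have "qsum n (\<lambda>a b x y. x < y) (\<lambda>a b. G a (a + b)) - qsum n (\<lambda>a b x y. b < a) G =
      2 * qsum n full (\<lambda>a b. of_nat (a * b) * f (int a))
      - qsum n (\<lambda>a b x y. x = y) (\<lambda>a b. G a (a + b))"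
    using tele by (simp add: algebra_simps)
  also have "qsum n (\<lambda>a b x y. x = y) (\<lambda>a b. G a (a + b)) =
      (\<Sum>d | d dvd n. \<Sum>a \<in> {1..<d}. of_nat (d * (d - a)) * f (int a))"
    by (auto simp: qsum_diag_xy[OF n] G_def of_nat_diff intro!: sum.cong)
  also have "qsum n (\<lambda>a b x y. x = y) (\<lambda>a b. of_nat (a * b) * f (int a + int b)) =
      (\<Sum>d | d dvd n. (\<Sum>a \<in> {1..<d}. of_nat (a * (d - a))) * f (int d))"
    by (auto simp: qsum_diag_xy[OF n] of_nat_diff sum_distrib_right intro!: sum.cong)
  also have "qsum n (\<lambda>a b x y. a = b) (\<lambda>a b. of_nat (a * b) * f 0) =
      (\<Sum>d | d dvd n. of_nat (n div d - 1) * of_nat (d * d) * f 0)"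
    by (simp add: qsum_diag_ab[OF n] mult_ac)
  finally show ?thesis
    by (simp add: sum_subtractf sum.distrib sum_distrib_left algebra_simps)
qed

section \<open>Lambert series and their products\<close>

text \<open>The divisors of \<open>0\<close> form an infinite set, so the coefficient at \<open>0\<close> is the junk value \<open>0\<close>.\<close>

definition lambert :: "(nat \<Rightarrow> 'c) \<Rightarrow> 'c :: comm_ring_1 fps" where
  "lambert g = Abs_fps (\<lambda>n. \<Sum>d | d dvd n. g d)"

lemma lambert_nth_0 [simp]: "lambert g $ 0 = 0"
  by (simp add: lambert_def)

lemma lambert_nth: "lambert g $ n = (\<Sum>d | d dvd n. g d)"
  by (simp add: lambert_def)

text \<open>A divisor \<open>a\<close> of \<open>i\<close> and a divisor \<open>b\<close> of
  \<open>n - i\<close> give the solution with \<open>x = i div a\<close> and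
  \<open>y = (n - i) div b\<close>.\<close>

lemma lambert_mult_nth: "(lambert g * lambert h) $ n = qsum n full (\<lambda>a b. g a * h b)"
proof -
  have "(lambert g * lambert h) $ n = (\<Sum>i=0..n. \<Sum>a | a dvd i. \<Sum>b | b dvd n - i. g a * h b)"
    by (simp add: fps_mult_nth lambert_nth sum_product)
  \<comment> \<open>At \<open>i = 0\<close> and \<open>i = n\<close> one of the two divisor sets is
    infinite, so the sum over it is \<open>0\<close> by convention.\<close>
  also have "\<dots> = (\<Sum>i=1..<n. \<Sum>a | a dvd i. \<Sum>b | b dvd n - i. g a * h b)"
    by (intro sum.mono_neutral_right) (auto simp: Suc_le_eq)
  also have "\<dots> = (\<Sum>(i, a, b) \<in> (SIGMA i : {1..<n}. {a. a dvd i} \<times> {b. b dvd n - i}). g a * h b)"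
    unfolding sum.cartesian_product by (rule sum.Sigma) auto
  also have "\<dots> = qsum n full (\<lambda>a b. g a * h b)"
    unfolding qsum_def
    by (rule sum.reindex_bij_witness[where
          j = "\<lambda>(i, a, b). (a, b, i div a, (n - i) div b)" and i = "\<lambda>(a, b, x, y). (a * x, a, b)"])
       (auto simp: quads_def dvd_div_eq_0_iff intro!: Nat.gr0I dvd_imp_le)
  finally show ?thesis .
qed

subsection \<open>Convolutions of the divisor sums\<close>

text \<open>The series of \<open>Phi_tilde 0 s\<close>; its constant coefficient is
  \<open>0\<close>, whatever the value of \<open>sigma_tilde s 0\<close>.\<close>

definition Phi_fps :: "nat \<Rightarrow> complex fps" where
  "Phi_fps s = lambert (\<lambda>d. (- 1) ^ (d - 1) * of_nat d ^ s)"

definition q_deriv_fps :: "complex fps \<Rightarrow> complex fps" where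
  "q_deriv_fps F = fps_X * fps_deriv F"

lemma q_deriv_fps_nth [simp]: "q_deriv_fps F $ n = of_nat n * F $ n"
  by (cases n) (simp_all add: q_deriv_fps_def)

lemma alternating_sum_squares:
  "2 * (\<Sum>a \<in> {1..<d}. (- 1) ^ a * of_nat a ^ 2 :: complex) =
    (- 1) ^ d * (of_nat d - of_nat d ^ 2)"
proof (induction d)
  case (Suc d)
  then show ?case
    by (cases d) (simp_all add: algebra_simps power2_eq_square)
qed simp

lemma alternating_sum_fourth_powers:
  "2 * (\<Sum>a \<in> {1..<d}. (- 1) ^ a * of_nat a ^ 4 :: complex) =
    (- 1) ^ d * (2 * of_nat d ^ 3 - of_nat d - of_nat d ^ 4)"
proof (induction d)
  case (Suc d)
  then show ?case
    by (cases d) (simp_all add: algebra_simps power2_eq_square power3_eq_cube power4_eq_xxxx)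
qed simp

text \<open>For even \<open>k\<close> these are the even functions put into
  \<open>qsum_even_diff\<close>. As \<open>a - b\<close> and \<open>a + b\<close> have the same
  parity, both carry the sign \<open>(- 1) ^ (a + b)\<close> that occurs in products of two series
  \<open>Phi_fps\<close>.\<close>

definition alternating_power :: "nat \<Rightarrow> int \<Rightarrow> complex" where
  "alternating_power k m = (- 1) ^ nat \<bar>m\<bar> * of_int m ^ k"

lemma minus_one_power_nat_abs_add: "(- 1 :: 'c :: ring_1) ^ nat \<bar>int a + int b\<bar> = (- 1) ^ (a + b)"
  by (simp add: nat_add_distrib flip: of_nat_add)

lemma minus_one_power_nat_abs_diff: "(- 1 :: 'c :: ring_1) ^ nat \<bar>int a - int b\<bar> = (- 1) ^ (a + b)"
  by (simp add: minus_one_power_iff even_nat_iff)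

lemma alternating_power_add: "alternating_power k (int a + int b) = (- 1) ^ (a + b) * (of_nat a + of_nat b) ^ k"
  and alternating_power_diff: "alternating_power k (int a - int b) = (- 1) ^ (a + b) * (of_nat a - of_nat b) ^ k"
  unfolding alternating_power_def minus_one_power_nat_abs_add minus_one_power_nat_abs_diff by simp_all

lemma minus_one_power_pred: "d > 0 \<Longrightarrow> (- 1 :: 'c :: ring_1) ^ (d - Suc 0) = - ((- 1) ^ d)"
  by (cases d) auto

lemma sum_divisors_alternating:
  assumes "n > 0"
  shows "(\<Sum>d | d dvd n. (- 1) ^ d * of_nat d ^ s) = - (Phi_fps s $ n)"
  unfolding Phi_fps_def lambert_def fps_nth_Abs_fps sum_negf[symmetric]
  using assms by (intro sum.cong) (auto simp: minus_one_power_pred dvd_pos_nat)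

text \<open>In \<open>qsum_even_diff\<close>, \<open>(n div d - 1) d ^ k\<close> becomes
  \<open>n d ^ (k - 1) - d ^ k\<close>, the value at \<open>0\<close> vanishes because
  \<open>k > 0\<close>, and \<open>p\<close> supplies the inner power sum.\<close>

lemma qsum_alternating_power:
  assumes n: "n > 0" and k: "even k" "k > 0"
    and p: "\<And>d. 2 * (\<Sum>a \<in> {1..<d}. (- 1) ^ a * of_nat a ^ k) = (- 1) ^ d * p d"
  shows "qsum n full (\<lambda>a b. alternating_power k (int a - int b) - alternating_power k (int a + int b)) =
    (\<Sum>d | d dvd n. (- 1) ^ d * (2 * of_nat n * of_nat d ^ (k - 1) - of_nat d ^ k - of_nat d ^ (k + 1) - p d))"
proof (subst qsum_even_diff[OF _ n], goal_cases)
  case 1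
  then show ?case using k by (simp add: alternating_power_def)
next
  case 2
  show ?case
  proof (rule sum.cong[OF refl], safe)
    fix d assume d: "d dvd n"
    with n obtain e where e: "n = d * e" "e > 0" "d > 0" by auto
    obtain l where l: "k = Suc l" using k(2) gr0_implies_Suc by blast
    have "2 * (\<Sum>a \<in> {1..<d}. alternating_power k (int a)) = (- 1) ^ d * p d"
      using p[of d] by (simp add: alternating_power_def)
    then show "of_nat (n div d - 1) * (2 * alternating_power k (int d) + alternating_power k 0) - of_nat (d - 1) * alternating_power k (int d)
        - 2 * (\<Sum>a \<in> {1..<d}. alternating_power k (int a)) =
        (- 1) ^ d * (2 * of_nat n * of_nat d ^ (k - 1) - of_nat d ^ k - of_nat d ^ (k + 1) - p d)"
      using e by (simp add: alternating_power_def of_nat_diff algebra_simps l)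
  qed
qed

lemma Phi_fps_mult_nth:
  "(Phi_fps r * Phi_fps s) $ n = qsum n full (\<lambda>a b. (- 1) ^ (a + b) * of_nat a ^ r * of_nat b ^ s)"
  unfolding Phi_fps_def lambert_mult_nth
  by (intro qsum_cong) (auto simp: quads_def minus_one_power_pred power_add)

text \<open>Rests on \<open>(a - b) ^ 2 - (a + b) ^ 2 = - 4 a b\<close>.\<close>

lemma Phi_fps_1_squared:
  "4 * Phi_fps 1 ^ 2 = 2 * q_deriv_fps (Phi_fps 1) - Phi_fps 3 - Phi_fps 1"
proof (rule fps_ext)
  fix n
  show "(4 * Phi_fps 1 ^ 2) $ n = (2 * q_deriv_fps (Phi_fps 1) - Phi_fps 3 - Phi_fps 1) $ n"
  proof (cases "n = 0")
    case False
    then have n: "n > 0" by simp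
    have "4 * (Phi_fps 1 * Phi_fps 1) $ n =
        - qsum n full (\<lambda>a b. alternating_power 2 (int a - int b) - alternating_power 2 (int a + int b))"
      unfolding Phi_fps_mult_nth qsum_mult[symmetric] qsum_uminus[symmetric]
      by (intro qsum_cong)
         (auto simp: alternating_power_add alternating_power_diff power2_eq_square algebra_simps)
    also have "\<dots> = - (\<Sum>d | d dvd n. 2 * of_nat n * ((- 1) ^ d * of_nat d ^ 1)
        - (- 1) ^ d * of_nat d ^ 3 - (- 1) ^ d * of_nat d ^ 1)"
      by (subst qsum_alternating_power[OF n _ _ alternating_sum_squares])
         (simp_all add: algebra_simps power2_eq_square power3_eq_cube)
    finally show ?thesis
      by (simp add: sum_subtractf sum_divisors_alternating[OF n]
          sum_divisors_alternating[OF n, of 1, simplified] power2_eq_square fps_numeral_nth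
          numeral_fps_const flip: sum_distrib_left)
  qed (simp add: power2_eq_square Phi_fps_def)
qed

text \<open>Rests on \<open>(a - b) ^ 4 - (a + b) ^ 4 = - 8 (a ^ 3 b + a b ^ 3)\<close>. Both
  monomials give the same product of series, whence the factor 16.\<close>

lemma Phi_fps_1_mult_3:
  "16 * (Phi_fps 1 * Phi_fps 3) =
    2 * q_deriv_fps (Phi_fps 3) - Phi_fps 5 - 2 * Phi_fps 3 + Phi_fps 1"
proof (rule fps_ext)
  fix n
  show "(16 * (Phi_fps 1 * Phi_fps 3)) $ n =
      (2 * q_deriv_fps (Phi_fps 3) - Phi_fps 5 - 2 * Phi_fps 3 + Phi_fps 1) $ n"
  proof (cases "n = 0")
    case False
    then have n: "n > 0" by simp
    have "16 * (Phi_fps 1 * Phi_fps 3) $ n =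
        8 * (Phi_fps 1 * Phi_fps 3) $ n + 8 * (Phi_fps 3 * Phi_fps 1) $ n"
      by (simp add: mult.commute)
    also have "\<dots> = - qsum n full (\<lambda>a b. alternating_power 4 (int a - int b) - alternating_power 4 (int a + int b))"
      unfolding Phi_fps_mult_nth qsum_mult[symmetric] qsum_uminus[symmetric] qsum_add[symmetric]
      by (intro qsum_cong)
         (auto simp: alternating_power_add alternating_power_diff power4_eq_xxxx power3_eq_cube algebra_simps)
    also have "\<dots> = - (\<Sum>d | d dvd n. 2 * of_nat n * ((- 1) ^ d * of_nat d ^ 3)
        - (- 1) ^ d * of_nat d ^ 5 - 2 * ((- 1) ^ d * of_nat d ^ 3) + (- 1) ^ d * of_nat d ^ 1)"
      by (subst qsum_alternating_power[OF n _ _ alternating_sum_fourth_powers])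
         (simp_all add: algebra_simps)
    finally show ?thesis
      by (simp add: sum_subtractf sum.distrib sum_divisors_alternating[OF n]
          sum_divisors_alternating[OF n, of 1, simplified] fps_numeral_nth
          numeral_fps_const flip: sum_distrib_left)
  qed (simp add: Phi_fps_def)
qed

subsection \<open>The Fejer kernel and the square of the Lambert series\<close>

text \<open>The series of \<open>cosh (m t)\<close> in \<open>t\<close>.\<close>

definition fps_cosh :: "int \<Rightarrow> complex fps" where
  "fps_cosh m = fps_const (1 / 2) * (fps_exp (of_int m) + fps_exp (- of_int m))"

lemma fps_cosh_altdef: "2 * fps_cosh m = fps_exp (of_int m) + fps_exp (- of_int m)"
proof -
  have "2 * fps_const (1 / 2 :: complex) = 1"
    by (simp add: numeral_fps_const)
  then show ?thesis
    by (simp add: fps_cosh_def flip: mult.assoc)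
qed

lemma fps_cosh_nth: "fps_cosh m $ k = (if even k then of_int m ^ k / fact k else 0)"
  by (auto simp: fps_cosh_def)

lemma fps_cosh_0 [simp]: "fps_cosh 0 = 1"
  by (simp add: fps_eq_iff fps_cosh_nth power_0_left)

lemma fps_cosh_minus: "fps_cosh (- m) = fps_cosh m"
  by (simp add: fps_cosh_def add.commute)

lemma fps_cosh_mult: "2 * (fps_cosh a * fps_cosh b) = fps_cosh (a + b) + fps_cosh (a - b)"
proof -
  have "4 * (fps_cosh a * fps_cosh b) = (2 * fps_cosh a) * (2 * fps_cosh b)"
    by simp
  also have "\<dots> = 2 * fps_cosh (a + b) + 2 * fps_cosh (a - b)"
    unfolding fps_cosh_altdef by (simp add: algebra_simps flip: fps_exp_add_mult)
  finally have "2 * (2 * (fps_cosh a * fps_cosh b)) = 2 * (fps_cosh (a + b) + fps_cosh (a - b))"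
    by (simp add: algebra_simps)
  then show ?thesis by (subst (asm) mult_cancel_left) simp
qed

lemma fps_deriv2_cosh: "fps_deriv (fps_deriv (fps_cosh m)) = of_int m ^ 2 * fps_cosh m"
proof -
  have neg: "fps_const (- of_int m :: complex) = - of_int m"
    by (metis fps_const_neg fps_of_int)
  have "fps_deriv (fps_deriv (fps_cosh m)) = fps_const (1 / 2) *
      (fps_const (of_int m) * (fps_const (of_int m) * fps_exp (of_int m)) +
       fps_const (- of_int m) * (fps_const (- of_int m) * fps_exp (- of_int m)))"
    unfolding fps_cosh_def by (simp only: fps_deriv_mult_const_left fps_deriv_add fps_exp_deriv)
  then show ?thesis
    unfolding neg fps_of_int fps_cosh_def by (simp add: power2_eq_square algebra_simps)
qed

lemma fps_deriv_cosh_1_squared: "fps_deriv (fps_cosh 1) ^ 2 = fps_cosh 1 ^ 2 - 1"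
proof -
  have 1: "fps_exp 1 * fps_exp (- 1 :: complex) = 1"
    by (simp flip: fps_exp_add_mult)
  have neg: "fps_const (- 1 :: complex) = - 1"
    by (metis fps_const_1_eq_1 fps_const_neg)
  have "(2 * fps_deriv (fps_cosh 1)) ^ 2 = (fps_deriv (2 * fps_cosh 1)) ^ 2"
    by (simp add: fps_deriv_mult)
  also have "\<dots> = (2 * fps_cosh 1) ^ 2 - 4"
    unfolding fps_cosh_altdef using 1 by (simp add: power2_eq_square algebra_simps neg)
  finally have "4 * fps_deriv (fps_cosh 1) ^ 2 = 4 * (fps_cosh 1 ^ 2 - 1)"
    by (simp add: power_mult_distrib algebra_simps)
  then show ?thesis by (subst (asm) mult_cancel_left) simp
qed

text \<open>The series of \<open>sech (t / 2) ^ 2 / 4\<close>, because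
  \<open>2 + 2 cosh t = 4 cosh (t / 2) ^ 2\<close>.\<close>

definition sech2 :: "complex fps" where
  "sech2 = inverse (2 + 2 * fps_cosh 1)"

lemma sech2_mult: "(2 + 2 * fps_cosh 1) * sech2 = 1"
  unfolding sech2_def by (rule inverse_mult_eq_1') (simp add: fps_cosh_nth fps_numeral_nth)

text \<open>The denominator \<open>g\<close> satisfies \<open>g' ^ 2 = g ^ 2 - 4 g\<close> and
  \<open>g'' = g - 2\<close>; differentiating \<open>g * sech2 = 1\<close> twice carries this over
  to the reciprocal.\<close>

lemma sech2_ode: "fps_deriv (fps_deriv sech2) = sech2 - 6 * sech2 ^ 2"
proof -
  define g where "g = 2 + 2 * fps_cosh 1"
  have gs: "g * sech2 = 1" unfolding g_def by (rule sech2_mult)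
  have g': "fps_deriv g ^ 2 = g ^ 2 - 4 * g"
    using fps_deriv_cosh_1_squared
    by (simp add: g_def fps_deriv_mult power_mult_distrib) (simp add: power2_eq_square algebra_simps)
  have g'': "fps_deriv (fps_deriv g) = g - 2"
    using fps_deriv2_cosh[of 1] by (simp add: g_def fps_deriv_mult)
  have 1: "fps_deriv g * sech2 + g * fps_deriv sech2 = 0"
    using arg_cong[OF gs, of fps_deriv] by (simp add: algebra_simps)
  have 2: "fps_deriv (fps_deriv g) * sech2 + 2 * (fps_deriv g * fps_deriv sech2) +
      g * fps_deriv (fps_deriv sech2) = 0"
    using arg_cong[OF 1, of fps_deriv] by (simp add: algebra_simps)
  have s': "fps_deriv sech2 = - (fps_deriv g * sech2 ^ 2)"
    using gs 1 by algebra
  have "fps_deriv (fps_deriv sech2) = - (sech2 ^ 2 * (g - 2)) + 2 * ((g ^ 2 - 4 * g) * sech2 ^ 3)"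
    using gs 2 g' unfolding s' g'' by algebra
  then show ?thesis using gs by algebra
qed

text \<open>An alternating Dirichlet kernel: multiplication by \<open>2 cosh t\<close> shifts the
  frequencies up and down by one, so all terms cancel except those at \<open>d\<close> and
  \<open>d + 1\<close>.\<close>

lemma alternating_cosh_sum:
  "(2 + 2 * fps_cosh 1) * (1 + 2 * (\<Sum>a \<in> {1..<Suc d}. (- 1) ^ a * fps_cosh (int a))) =
    2 * (- 1) ^ d * (fps_cosh (int d) + fps_cosh (int d + 1))"
proof (induction d)
  case (Suc d)
  have "(2 + 2 * fps_cosh 1) * (1 + 2 * (\<Sum>a \<in> {1..<Suc (Suc d)}. (- 1) ^ a * fps_cosh (int a))) =
    (2 + 2 * fps_cosh 1) * (1 + 2 * (\<Sum>a \<in> {1..<Suc d}. (- 1) ^ a * fps_cosh (int a))) +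
      (- 1) ^ Suc d * (4 * fps_cosh (int d + 1) + 2 * (2 * (fps_cosh (int d + 1) * fps_cosh 1)))"
    by (simp add: algebra_simps)
  then show ?case
    unfolding Suc.IH fps_cosh_mult by (simp add: algebra_simps)
qed simp

lemma sum_linear_weight_Suc:
  fixes h :: "nat \<Rightarrow> 'c :: comm_ring_1"
  shows "(\<Sum>a \<in> {1..<Suc d}. (of_nat (Suc d) - of_nat a) * h a) =
    (\<Sum>a \<in> {1..<d}. (of_nat d - of_nat a) * h a) + (\<Sum>a \<in> {1..<Suc d}. h a)"
proof -
  have "(\<Sum>a \<in> {1..<Suc d}. (of_nat (Suc d) - of_nat a) * h a) =
      (\<Sum>a \<in> {1..<Suc d}. (of_nat d - of_nat a) * h a) + (\<Sum>a \<in> {1..<Suc d}. h a)"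
    unfolding sum.distrib[symmetric] by (intro sum.cong) (simp_all add: algebra_simps)
  also have "(\<Sum>a \<in> {1..<Suc d}. (of_nat d - of_nat a) * h a) =
      (\<Sum>a \<in> {1..<d}. (of_nat d - of_nat a) * h a)"
    by (cases d) simp_all
  finally show ?thesis .
qed

text \<open>The linear weights make the left-hand side a sum of the kernels in
  \<open>alternating_cosh_sum\<close>, whose values telescope; \<open>sech2\<close> then removes the
  common factor.\<close>

lemma alternating_cosh_fejer:
  "of_nat d + 2 * (\<Sum>a \<in> {1..<d}. (of_nat d - of_nat a) * ((- 1) ^ a * fps_cosh (int a))) =
    2 * sech2 * (1 - (- 1) ^ d * fps_cosh (int d))"
proof -
  have "(2 + 2 * fps_cosh 1) *
      (of_nat d + 2 * (\<Sum>a \<in> {1..<d}. (of_nat d - of_nat a) * ((- 1) ^ a * fps_cosh (int a)))) =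
      2 - 2 * (- 1) ^ d * fps_cosh (int d)"
  proof (induction d)
    case (Suc d)
    have *: "(\<Sum>a \<in> {1..<Suc d}. (of_nat (Suc d) - of_nat a) * ((- 1) ^ a * fps_cosh (int a))) =
        (\<Sum>a \<in> {1..<d}. (of_nat d - of_nat a) * ((- 1) ^ a * fps_cosh (int a))) +
        (\<Sum>a \<in> {1..<Suc d}. (- 1) ^ a * fps_cosh (int a))"
      by (rule sum_linear_weight_Suc)
    have split: "k * (of_nat (Suc d) + 2 * (A + B)) = k * (of_nat d + 2 * A) + k * (1 + 2 * B)"
      for k A B :: "complex fps"
      by (simp add: algebra_simps)
    then show ?case
      unfolding * split Suc.IH alternating_cosh_sum by (simp add: algebra_simps)
  qed simp
  then have "sech2 * ((2 + 2 * fps_cosh 1) *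
      (of_nat d + 2 * (\<Sum>a \<in> {1..<d}. (of_nat d - of_nat a) * ((- 1) ^ a * fps_cosh (int a))))) =
      sech2 * (2 - 2 * (- 1) ^ d * fps_cosh (int d))"
    by simp
  then show ?thesis
    unfolding mult.assoc[symmetric] mult.commute[of sech2] sech2_mult by (simp add: algebra_simps)
qed

lemma sum_mult_diff_self:
  "6 * (\<Sum>a \<in> {1..<d}. of_nat a * (of_nat d - of_nat a) :: 'c :: comm_ring_1) =
    of_nat d ^ 3 - of_nat d"
proof (induction d)
  case (Suc d)
  have sum: "2 * (\<Sum>a \<in> {1..<Suc d}. of_nat a :: 'c) = of_nat d * of_nat (Suc d)"
    by (induction d) (simp_all add: algebra_simps)
  have "(\<Sum>a \<in> {1..<Suc d}. of_nat a * (of_nat (Suc d) - of_nat a) :: 'c) =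
      (\<Sum>a \<in> {1..<d}. of_nat a * (of_nat d - of_nat a)) + (\<Sum>a \<in> {1..<Suc d}. of_nat a)"
    using sum_linear_weight_Suc[of d of_nat] by (simp only: mult.commute)
  then have "6 * (\<Sum>a \<in> {1..<Suc d}. of_nat a * (of_nat (Suc d) - of_nat a) :: 'c) =
      (of_nat d ^ 3 - of_nat d) + 3 * (2 * (\<Sum>a \<in> {1..<Suc d}. of_nat a))"
    using Suc.IH by (simp add: algebra_simps)
  then show ?case
    unfolding sum by (simp add: algebra_simps power3_eq_cube)
qed simp

text \<open>
  In the type \<open>complex fps fps\<close> the outer variable is \<open>q\<close> and the inner one is \<open>t\<close>.
\<close>

definition W_fps :: "complex fps fps" where
  "W_fps = lambert (\<lambda>a. (- 1) ^ (a - 1) * of_nat a * fps_cosh (int a))"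

lemma W_fps_nth:
  assumes "n > 0"
  shows "W_fps $ n = - (\<Sum>d | d dvd n. of_nat d * ((- 1) ^ d * fps_cosh (int d)))"
  unfolding W_fps_def lambert_nth sum_negf[symmetric]
  using assms by (intro sum.cong) (auto simp: minus_one_power_pred dvd_pos_nat algebra_simps)

lemma W_fps_deriv2_nth:
  assumes "n > 0"
  shows "fps_deriv (fps_deriv (W_fps $ n)) =
    - (\<Sum>d | d dvd n. of_nat d ^ 3 * ((- 1) ^ d * fps_cosh (int d)))"
proof -
  have *: "fps_deriv (fps_deriv (of_nat d * ((- 1) ^ d * fps_cosh (int d)))) =
      of_nat d ^ 3 * ((- 1) ^ d * fps_cosh (int d))" for d
  proof -
    \<comment> \<open>\<open>fps_deriv\<close> acts on the inner variable \<open>t\<close>, for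
      which signs and integers have to be recognized as constants.\<close>
    have "(- 1 :: complex fps) ^ d = fps_const ((- 1) ^ d)"
      by (cases "even d") (simp_all flip: fps_const_neg)
    then have c: "of_nat d * (- 1 :: complex fps) ^ d = fps_const (of_nat d * (- 1) ^ d)"
      by (simp flip: fps_of_nat)
    have "fps_deriv (fps_deriv (of_nat d * (- 1) ^ d * fps_cosh (int d))) =
        of_nat d * (- 1) ^ d * (of_nat d ^ 2 * fps_cosh (int d))"
      unfolding c by (simp add: fps_deriv2_cosh)
    then show ?thesis
      by (simp add: power2_eq_square power3_eq_cube mult_ac)
  qed
  show ?thesis
    by (simp only: W_fps_nth[OF assms] fps_deriv_neg fps_deriv_sum *)
qed

text \<open>By \<open>fps_cosh_mult\<close> this is a case of \<open>qsum_even_mult_sum\<close> with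
  \<open>f m = (- 1) ^ m cosh (m t)\<close>. Among the divisor sums that remain, \<open>f 0\<close>
  gives the term with the factor \<open>n\<close>, the sum of \<open>a (d - a)\<close> gives
  \<open>W_fps\<close> and its second derivative, and the Fejer kernel gives the terms with
  \<open>sech2\<close>.\<close>

lemma W_fps_squared_nth:
  assumes n: "n > 0"
  shows "12 * (W_fps * W_fps) $ n = - 24 * (W_fps * lambert of_nat) $ n
    + 6 * of_nat n * lambert of_nat $ n - fps_deriv (fps_deriv (W_fps $ n)) + W_fps $ n
    - 12 * sech2 * lambert of_nat $ n - 12 * sech2 * W_fps $ n"
proof -
  define f :: "int \<Rightarrow> complex fps" where "f = (\<lambda>m. (- 1) ^ nat \<bar>m\<bar> * fps_cosh m)"
  have f_int: "f (int d) = (- 1) ^ d * fps_cosh (int d)" for d by (simp add: f_def)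
  have f_0: "f 0 = 1" by (simp add: f_def)
  have f_add: "f (int a + int b) = (- 1) ^ (a + b) * fps_cosh (int a + int b)"
    and f_diff: "f (int a - int b) = (- 1) ^ (a + b) * fps_cosh (int a - int b)" for a b
    unfolding f_def minus_one_power_nat_abs_add minus_one_power_nat_abs_diff by simp_all
  have "2 * (W_fps * W_fps) $ n =
      qsum n full (\<lambda>a b. of_nat (a * b) * (f (int a + int b) + f (int a - int b)))"
    unfolding W_fps_def lambert_mult_nth qsum_mult[symmetric] f_add f_diff distrib_left[symmetric]
      fps_cosh_mult[symmetric]
    by (intro qsum_cong) (auto simp: quads_def minus_one_power_pred power_add algebra_simps)
  also have "\<dots> = 4 * qsum n full (\<lambda>a b. of_nat (a * b) * f (int a)) +
    (\<Sum>d | d dvd n. of_nat (n div d - 1) * of_nat (d * d) * f 0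
      + (\<Sum>a \<in> {1..<d}. of_nat (a * (d - a))) * f (int d)
      - 2 * (\<Sum>a \<in> {1..<d}. of_nat (d * (d - a)) * f (int a)))"
    using n by (intro qsum_even_mult_sum) (simp_all add: f_def fps_cosh_minus)
  also have "qsum n full (\<lambda>a b. of_nat (a * b) * f (int a)) = - ((W_fps * lambert of_nat) $ n)"
    unfolding W_fps_def lambert_mult_nth qsum_uminus[symmetric]
    by (intro qsum_cong) (auto simp: quads_def minus_one_power_pred f_int)
  finally have double: "2 * (W_fps * W_fps) $ n = 4 * - ((W_fps * lambert of_nat) $ n) +
    (\<Sum>d | d dvd n. of_nat (n div d - 1) * of_nat (d * d) * f 0
      + (\<Sum>a \<in> {1..<d}. of_nat (a * (d - a))) * f (int d)
      - 2 * (\<Sum>a \<in> {1..<d}. of_nat (d * (d - a)) * f (int a)))" .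
  \<comment> \<open>The factor 6 clears the denominator of \<open>(d ^ 3 - d) / 6\<close>, the sum
    of \<open>a (d - a)\<close> over \<open>0 < a < d\<close>.\<close>
  have eq: "12 * (W_fps * W_fps) $ n = - 24 * (W_fps * lambert of_nat) $ n +
    (\<Sum>d | d dvd n. 6 * (of_nat (n div d - 1) * of_nat (d * d) * f 0
      + (\<Sum>a \<in> {1..<d}. of_nat (a * (d - a))) * f (int d)
      - 2 * (\<Sum>a \<in> {1..<d}. of_nat (d * (d - a)) * f (int a))))"
  proof -
    have "12 * (W_fps * W_fps) $ n = 6 * (2 * (W_fps * W_fps) $ n)" by simp
    then show ?thesis
      unfolding double sum_distrib_left[symmetric] by (simp add: algebra_simps)
  qed
  have "(\<Sum>d | d dvd n. 6 * (of_nat (n div d - 1) * of_nat (d * d) * f 0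
      + (\<Sum>a \<in> {1..<d}. of_nat (a * (d - a))) * f (int d)
      - 2 * (\<Sum>a \<in> {1..<d}. of_nat (d * (d - a)) * f (int a)))) =
    (\<Sum>d | d dvd n. 6 * of_nat n * of_nat d + (of_nat d ^ 3 * f (int d) - of_nat d * f (int d))
      - 12 * sech2 * of_nat d + 12 * sech2 * (of_nat d * f (int d)))"
  proof (rule sum.cong[OF refl], safe)
    fix d assume "d dvd n"
    with n obtain e where e: "n = d * e" "e > 0" "d > 0" by auto
    have "6 * (\<Sum>a \<in> {1..<d}. of_nat (a * (d - a)) :: complex fps) = of_nat d ^ 3 - of_nat d"
      unfolding sum_mult_diff_self[symmetric]
      by (intro arg_cong[where f = "\<lambda>x. 6 * x"] sum.cong) (auto simp: of_nat_diff)
    then have 1: "6 * ((\<Sum>a \<in> {1..<d}. of_nat (a * (d - a))) * f (int d)) =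
        (of_nat d ^ 3 - of_nat d) * f (int d)"
      by (simp flip: mult.assoc)
    have "2 * (\<Sum>a \<in> {1..<d}. of_nat (d * (d - a)) * f (int a)) =
        of_nat d * (2 * (\<Sum>a \<in> {1..<d}. (of_nat d - of_nat a) * f (int a)))"
      by (simp add: sum_distrib_left of_nat_diff algebra_simps)
    also have "2 * (\<Sum>a \<in> {1..<d}. (of_nat d - of_nat a) * f (int a)) =
        2 * sech2 * (1 - f (int d)) - of_nat d"
      using alternating_cosh_fejer[of d] by (simp add: f_int algebra_simps)
    finally have 2: "2 * (\<Sum>a \<in> {1..<d}. of_nat (d * (d - a)) * f (int a)) =
        of_nat d * (2 * sech2 * (1 - f (int d)) - of_nat d)" .
    have 3: "of_nat (n div d - 1) * of_nat (d * d) * f 0 =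
        of_nat n * of_nat d - (of_nat d ^ 2 :: complex fps)"
      using e by (simp add: f_0 of_nat_diff algebra_simps power2_eq_square)
    show "6 * (of_nat (n div d - 1) * of_nat (d * d) * f 0
        + (\<Sum>a \<in> {1..<d}. of_nat (a * (d - a))) * f (int d)
        - 2 * (\<Sum>a \<in> {1..<d}. of_nat (d * (d - a)) * f (int a))) =
      6 * of_nat n * of_nat d + (of_nat d ^ 3 * f (int d) - of_nat d * f (int d))
        - 12 * sech2 * of_nat d + 12 * sech2 * (of_nat d * f (int d))"
      unfolding distrib_left right_diff_distrib[of 6] 1 2 3
      by (simp add: algebra_simps power2_eq_square)
  qed
  also have "\<dots> = 6 * of_nat n * lambert of_nat $ n - fps_deriv (fps_deriv (W_fps $ n)) + W_fps $ n
      - 12 * sech2 * lambert of_nat $ n - 12 * sech2 * W_fps $ n"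
    unfolding W_fps_deriv2_nth[OF n] unfolding W_fps_nth[OF n] lambert_nth f_int
    by (simp add: sum.distrib sum_subtractf sum_distrib_left)
  finally show ?thesis
    unfolding eq by (simp only:) (simp add: algebra_simps)
qed

subsection \<open>The differential equation and its Taylor coefficients\<close>

definition U_fps :: "complex fps fps" where
  "U_fps = fps_const sech2 + 2 * W_fps"

text \<open>The Eisenstein series of weight 2.\<close>

definition E2_fps :: "complex fps" where
  "E2_fps = 1 - 24 * lambert of_nat"

lemma fps_numeral_mult_nth [simp]:
  "(numeral k * (F :: 'c :: comm_ring_1 fps)) $ n = numeral k * F $ n"
  by (simp add: numeral_fps_const)

lemma lambert_of_nat_nth: "lambert of_nat $ n = of_nat (\<Sum>d | d dvd n. d)"
  by (simp add: lambert_nth)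

text \<open>At \<open>n = 0\<close> this is \<open>sech2_ode\<close>. For \<open>n > 0\<close> the
  second derivative and the mixed products of \<open>sech2\<close> and \<open>W_fps\<close> in
  \<open>W_fps_squared_nth\<close> cancel against those that come from \<open>U_fps\<close>.\<close>

lemma U_fps_ode:
  "fps_deriv (fps_deriv (U_fps $ n)) + 6 * (U_fps * U_fps) $ n =
    ((1 - 24 * lambert of_nat) * U_fps) $ n + 12 * of_nat n * lambert of_nat $ n"
proof (cases "n = 0")
  case True
  then show ?thesis
    by (simp add: U_fps_def W_fps_def sech2_ode power2_eq_square)
next
  case False
  then have n: "n > 0" by simp
  have UU: "U_fps * U_fps = fps_const (sech2 ^ 2) + 4 * (fps_const sech2 * W_fps) + 4 * (W_fps * W_fps)"
    by (simp add: U_fps_def algebra_simps power2_eq_square)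
  have EU: "(1 - 24 * lambert of_nat) * U_fps = fps_const sech2 + 2 * W_fps
      - 24 * (fps_const sech2 * lambert of_nat) - 48 * (W_fps * lambert of_nat)"
    by (simp add: U_fps_def algebra_simps)
  have deriv: "fps_deriv (fps_deriv (U_fps $ n)) = 2 * fps_deriv (fps_deriv (W_fps $ n))"
    using n by (simp add: U_fps_def fps_deriv_mult)
  have "(U_fps * U_fps) $ n = 4 * (sech2 * W_fps $ n) + 4 * (W_fps * W_fps) $ n"
    using n by (simp add: UU)
  then have UU_nth: "6 * (U_fps * U_fps) $ n = 24 * sech2 * W_fps $ n + 2 * (12 * (W_fps * W_fps) $ n)"
    by (simp add: algebra_simps)
  have EU_nth: "((1 - 24 * lambert of_nat) * U_fps) $ n =
      2 * W_fps $ n - 24 * sech2 * lambert of_nat $ n - 48 * (W_fps * lambert of_nat) $ n"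
    using n by (simp add: EU)
  show ?thesis
    unfolding UU_nth EU_nth deriv W_fps_squared_nth[OF n] by (simp add: algebra_simps)
qed

text \<open>The Taylor coefficients in \<open>t\<close>: the roles of the two variables are
  exchanged, so that each coefficient is a series in \<open>q\<close>.\<close>

definition u_fps :: "nat \<Rightarrow> complex fps" where
  "u_fps k = Abs_fps (\<lambda>n. U_fps $ n $ k)"

lemma u_fps_nth [simp]: "u_fps k $ n = U_fps $ n $ k"
  by (simp add: u_fps_def)

lemma U_fps_mult_nth: "(U_fps * U_fps) $ n $ k = (\<Sum>i\<le>k. u_fps i * u_fps (k - i)) $ n"
proof -
  have "(U_fps * U_fps) $ n $ k = (\<Sum>j=0..n. \<Sum>i=0..k. U_fps $ j $ i * U_fps $ (n - j) $ (k - i))"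
    by (simp add: fps_mult_nth fps_sum_nth)
  also have "\<dots> = (\<Sum>i=0..k. \<Sum>j=0..n. U_fps $ j $ i * U_fps $ (n - j) $ (k - i))"
    by (rule sum.swap)
  finally show ?thesis
    by (simp add: fps_mult_nth fps_sum_nth atLeast0AtMost)
qed

text \<open>On the left \<open>lambert of_nat\<close> is a series over \<open>complex fps\<close>.
  Its coefficients are integers, hence constant in \<open>t\<close>, so it multiplies each Taylor
  coefficient separately.\<close>

lemma E2_U_mult_nth: "((1 - 24 * lambert of_nat) * U_fps) $ n $ k = (E2_fps * u_fps k) $ n"
proof -
  have "(1 - 24 * lambert of_nat :: complex fps fps) $ i = fps_const (E2_fps $ i)" for i
    by (cases "i = 0") (simp_all add: E2_fps_def lambert_of_nat_nth numeral_fps_const flip: fps_of_nat)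
  then show ?thesis
    by (simp add: fps_mult_nth[of _ _ n] fps_sum_nth)
qed

text \<open>Compares the coefficients of \<open>t ^ k\<close> in \<open>U_fps_ode\<close>. The last
  term is free of \<open>t\<close> and equals \<open>- 1/2\<close> times
  \<open>q_deriv_fps E2_fps\<close>.\<close>

lemma u_fps_recurrence:
  "of_nat ((k + 2) * (k + 1)) * u_fps (k + 2) + 6 * (\<Sum>i\<le>k. u_fps i * u_fps (k - i)) =
    E2_fps * u_fps k + (if k = 0 then 12 * q_deriv_fps (lambert of_nat) else 0)"
proof (rule fps_ext)
  fix n
  have deriv: "fps_deriv (fps_deriv (U_fps $ n)) $ k = of_nat ((k + 2) * (k + 1)) * U_fps $ n $ (k + 2)"
    by (simp add: algebra_simps)
  have const: "(12 * of_nat n * lambert of_nat $ n :: complex fps) $ k =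
      (if k = 0 then 12 * q_deriv_fps (lambert of_nat) else 0) $ n"
    by (simp add: lambert_of_nat_nth numeral_fps_const flip: fps_of_nat)
  have of_nat: "(of_nat m * F) $ n = of_nat m * F $ n" for m and F :: "complex fps"
    by (simp flip: fps_of_nat)
  have "(fps_deriv (fps_deriv (U_fps $ n)) + 6 * (U_fps * U_fps) $ n) $ k =
    (((1 - 24 * lambert of_nat) * U_fps) $ n + 12 * of_nat n * lambert of_nat $ n) $ k"
    by (simp only: U_fps_ode)
  then show "(of_nat ((k + 2) * (k + 1)) * u_fps (k + 2) + 6 * (\<Sum>i\<le>k. u_fps i * u_fps (k - i))) $ n =
    (E2_fps * u_fps k + (if k = 0 then 12 * q_deriv_fps (lambert of_nat) else 0)) $ n"
    by (simp only: fps_add_nth fps_numeral_mult_nth U_fps_mult_nth E2_U_mult_nth of_nat u_fps_nth deriv const)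
qed

lemma sech2_nth:
  "sech2 $ 0 = 1 / 4" "sech2 $ Suc 0 = 0" "sech2 $ 2 = - 1 / 16" "sech2 $ 4 = 1 / 96"
proof -
  have *: "((2 + 2 * fps_cosh 1) * sech2) $ n = 1 $ n" for n
    by (simp only: sech2_mult)
  show 0: "sech2 $ 0 = 1 / 4"
    using *[of 0] by (simp add: fps_cosh_nth fps_numeral_nth eq_divide_eq mult.commute)
  show 1: "sech2 $ Suc 0 = 0"
    using *[of 1] by (simp add: fps_mult_nth fps_cosh_nth fps_numeral_nth)
  have ode: "fps_deriv (fps_deriv sech2) $ n = sech2 $ n - 6 * (sech2 * sech2) $ n" for n
    by (simp add: sech2_ode power2_eq_square)
  have "2 * sech2 $ 2 = - 1 / 8"
    using ode[of 0] by (simp add: 0 numeral_2_eq_2)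
  then have "2 * sech2 $ 2 / 2 = - 1 / 8 / 2" by simp
  then show 2: "sech2 $ 2 = - 1 / 16" by simp
  have "12 * sech2 $ 4 = 1 / 8"
    using ode[of 2] 2 by (simp add: fps_mult_nth 0 1 numeral_2_eq_2 eval_nat_numeral)
  then show "sech2 $ 4 = 1 / 96" by (simp add: eq_divide_eq mult.commute)
qed

lemma fps_signed_of_nat_mult_nth:
  fixes F :: "'c :: comm_ring_1 fps"
  shows "((- 1) ^ m * of_nat a * F) $ k = (- 1) ^ m * of_nat a * F $ k"
  by (cases "even m") (simp_all flip: fps_of_nat)

text \<open>For even \<open>k\<close> the coefficient of \<open>t ^ k\<close> in
  \<open>cosh (a t)\<close> is \<open>a ^ k / k!\<close>; the factor \<open>a\<close> in
  \<open>W_fps\<close> raises the exponent to \<open>k + 1\<close>.\<close>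

lemma u_fps_even:
  assumes "even k"
  shows "u_fps k = fps_const (sech2 $ k) + fps_const (2 / fact k) * Phi_fps (k + 1)"
proof (rule fps_ext)
  fix n
  have "((- 1) ^ (a - 1) * of_nat a * fps_cosh (int a)) $ k =
      (- 1) ^ (a - 1) * of_nat a ^ (k + 1) / fact k" for a
    unfolding fps_signed_of_nat_mult_nth using assms by (simp add: fps_cosh_nth)
  then have "W_fps $ n $ k = Phi_fps (k + 1) $ n / fact k"
    by (simp only: W_fps_def Phi_fps_def lambert_nth fps_sum_nth sum_divide_distrib)
  then have "(2 * W_fps) $ n $ k = 2 / fact k * Phi_fps (k + 1) $ n"
    by (simp only: fps_numeral_mult_nth times_divide_eq_right times_divide_eq_left)
  then show "u_fps k $ n = (fps_const (sech2 $ k) + fps_const (2 / fact k) * Phi_fps (k + 1)) $ n"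
    by (cases "n = 0") (simp_all add: U_fps_def W_fps_def Phi_fps_def)
qed

lemma u_fps_1: "u_fps 1 = 0"
proof (rule fps_ext)
  fix n
  have "((- 1) ^ (a - Suc 0) * of_nat a * fps_cosh (int a)) $ Suc 0 = 0" for a
    unfolding fps_signed_of_nat_mult_nth by (simp add: fps_cosh_nth)
  then have "W_fps $ n $ 1 = 0"
    by (simp only: W_fps_def lambert_nth fps_sum_nth One_nat_def sum.neutral_const)
  then have "(2 * W_fps) $ n $ 1 = 0"
    by (simp only: fps_numeral_mult_nth mult_zero_right)
  then show "u_fps 1 $ n = 0 $ n"
    by (cases "n = 0") (simp_all add: U_fps_def sech2_nth)
qed

section \<open>The generators and their derivatives\<close>

definition P_fps :: "complex fps" where "P_fps = 1 + 8 * Phi_fps 1"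
definition Q_fps :: "complex fps" where "Q_fps = 1 - 16 * Phi_fps 3"
definition R_fps :: "complex fps" where "R_fps = 1 + 8 * Phi_fps 5"
definition E_fps :: "complex fps" where "E_fps = Abs_fps (\<lambda>n. 24 * sigma_hat n)"

text \<open>The multipliers are the reciprocals of the coefficients in
  \<open>sech2_nth\<close>.\<close>

lemma P_fps_eq: "P_fps = 4 * u_fps 0"
  and Q_fps_eq: "Q_fps = - 16 * u_fps 2"
  and R_fps_eq: "R_fps = 96 * u_fps 4"
  by (simp_all add: fps_eq_iff P_fps_def Q_fps_def R_fps_def u_fps_even sech2_nth fact_numeral fps_numeral_nth)

text \<open>Both divisor sums are the ordinary one minus a multiple of \<open>?s\<close>, twice for
  \<open>sigma_hat\<close> and four times for \<open>Phi_fps 1\<close>. These corrections cancel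
  because \<open>3 * 8 * 4 = 2 * 24 * 2\<close>.\<close>

lemma E2_fps_eq: "E2_fps = 3 * P_fps - 2 * E_fps"
proof (rule fps_ext)
  fix n
  show "E2_fps $ n = (3 * P_fps - 2 * E_fps) $ n"
  proof (cases "n = 0")
    case True
    then show ?thesis by (simp add: E2_fps_def P_fps_def Phi_fps_def E_fps_def sigma_hat_def)
  next
    case False
    then have n: "n > 0" by simp
    let ?\<sigma> = "\<Sum>d | d dvd n. of_nat d :: complex"
    let ?s = "\<Sum>e | e dvd n \<and> even (n div e). of_nat e :: complex"
    have fin: "finite {d. d dvd n}" using n by simp
    have pred: "(- 1 :: complex) ^ (m - Suc 0) = (if even m then - 1 else 1)" if "m > 0" for m
      using that by (cases m) auto
    have "sigma_hat n = (\<Sum>d | d dvd n. of_nat d - (if even (n div d) then 2 * of_nat d else 0))"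
      using n by (auto simp: sigma_hat_def pred div_greater_zero_iff dvd_imp_le dvd_pos_nat intro!: sum.cong)
    also have "\<dots> = ?\<sigma> - 2 * ?s"
      using fin by (simp add: sum_subtractf sum.If_cases sum_distrib_left Int_def)
    finally have hat: "sigma_hat n = ?\<sigma> - 2 * ?s" .
    have "Phi_fps 1 $ n = (\<Sum>d | d dvd n. of_nat d - (if even d then 2 * of_nat d else 0))"
      using n by (auto simp: Phi_fps_def lambert_nth pred dvd_pos_nat intro!: sum.cong)
    also have "\<dots> = ?\<sigma> - 2 * (\<Sum>d | d dvd n \<and> even d. of_nat d)"
      using fin by (simp add: sum_subtractf sum.If_cases sum_distrib_left Int_def)
    \<comment> \<open>An even divisor \<open>d\<close> corresponds to \<open>e = d div 2\<close>,
      for which \<open>n div e\<close> is even.\<close>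
    also have "(\<Sum>d | d dvd n \<and> even d. of_nat d :: complex) =
        (\<Sum>e | e dvd n \<and> even (n div e). of_nat (2 * e))"
    proof (rule sum.reindex_bij_witness[where i = "\<lambda>e. 2 * e" and j = "\<lambda>d. d div 2"])
      fix d assume d: "d \<in> {d. d dvd n \<and> even d}"
      then obtain e where e: "d = 2 * e" by auto
      with d obtain m where m: "n = 2 * e * m" by auto
      show "2 * (d div 2) = d" using e by simp
      show "d div 2 \<in> {e. e dvd n \<and> even (n div e)}" using e m n by auto
      show "of_nat (2 * (d div 2)) = (of_nat d :: complex)" using e by simp
    next
      fix e assume "e \<in> {e. e dvd n \<and> even (n div e)}"
      then obtain m where "n = e * (2 * m)" using n by (auto elim!: dvdE)
      then show "2 * e \<in> {d. d dvd n \<and> even d}" by auto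
      show "2 * e div 2 = e" by simp
    qed
    also have "\<dots> = 2 * ?s"
      by (simp add: sum_distrib_left)
    finally have tilde: "Phi_fps 1 $ n = ?\<sigma> - 4 * ?s" by simp
    show ?thesis
      using n by (simp add: E2_fps_def P_fps_def E_fps_def hat tilde[simplified] lambert_nth fps_numeral_nth)
  qed
qed

text \<open>The case \<open>k = 0\<close> of \<open>u_fps_recurrence\<close>, the only one that
  contains a derivative in \<open>q\<close>.\<close>

lemma q_deriv_E2: "4 * q_deriv_fps E2_fps = Q_fps - 3 * P_fps ^ 2 + 2 * E2_fps * P_fps"
proof -
  have S: "q_deriv_fps E2_fps = - 24 * q_deriv_fps (lambert of_nat)"
    by (simp add: E2_fps_def q_deriv_fps_def algebra_simps)
  have "2 * u_fps 2 + 6 * (u_fps 0 * u_fps 0) = E2_fps * u_fps 0 + 12 * q_deriv_fps (lambert of_nat)"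
    using u_fps_recurrence[of 0] by (simp add: numeral_2_eq_2)
  then have "8 * (2 * u_fps 2 + 6 * (u_fps 0 * u_fps 0)) =
      8 * (E2_fps * u_fps 0 + 12 * q_deriv_fps (lambert of_nat))" by simp
  then show ?thesis
    unfolding S P_fps_eq Q_fps_eq by (simp add: algebra_simps power2_eq_square)
qed

text \<open>The case \<open>k = 2\<close> of \<open>u_fps_recurrence\<close>: the
  \<open>P_fps\<close> part of \<open>E2_fps\<close> cancels the product of \<open>u_fps 0\<close>
  and \<open>u_fps 2\<close>, which leaves
  \<open>12 * u_fps 4 = - 2 * E_fps * u_fps 2\<close>.\<close>

lemma R_fps_factor: "R_fps = E_fps * Q_fps"
proof -
  have "12 * u_fps 4 + 12 * (u_fps 0 * u_fps 2) = E2_fps * u_fps 2"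
    using u_fps_recurrence[of 2] u_fps_1 by (simp add: numeral_2_eq_2 eval_nat_numeral)
  then have "16 * (12 * u_fps 4 + 12 * (u_fps 0 * u_fps 2)) = 16 * (E2_fps * u_fps 2)" by simp
  then have "2 * R_fps = 2 * (E_fps * Q_fps)"
    unfolding E2_fps_eq P_fps_eq Q_fps_eq R_fps_eq by algebra
  then show ?thesis by (subst (asm) mult_cancel_left) simp
qed

lemma q_deriv_fps_simps:
  "q_deriv_fps (F + G) = q_deriv_fps F + q_deriv_fps G"
  "q_deriv_fps (F - G) = q_deriv_fps F - q_deriv_fps G"
  "q_deriv_fps (- F) = - q_deriv_fps F"
  "q_deriv_fps (F * G) = q_deriv_fps F * G + F * q_deriv_fps G"
  "q_deriv_fps (fps_const c) = 0"
  "q_deriv_fps (numeral k) = 0"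
  "q_deriv_fps 1 = 0"
  "q_deriv_fps 0 = 0"
  by (simp_all add: q_deriv_fps_def algebra_simps)

lemma q_deriv_P: "4 * q_deriv_fps P_fps = P_fps ^ 2 - Q_fps"
proof -
  have "4 * q_deriv_fps P_fps = 16 * (2 * q_deriv_fps (Phi_fps 1))"
    by (simp add: P_fps_def q_deriv_fps_simps)
  also have "2 * q_deriv_fps (Phi_fps 1) = 4 * Phi_fps 1 ^ 2 + Phi_fps 3 + Phi_fps 1"
    unfolding Phi_fps_1_squared by simp
  finally show ?thesis
    by (simp add: P_fps_def Q_fps_def power2_eq_square algebra_simps)
qed

lemma q_deriv_Q: "q_deriv_fps Q_fps = P_fps * Q_fps - R_fps"
proof -
  have "q_deriv_fps Q_fps = - 8 * (2 * q_deriv_fps (Phi_fps 3))"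
    by (simp add: Q_fps_def q_deriv_fps_simps)
  also have "2 * q_deriv_fps (Phi_fps 3) =
      16 * (Phi_fps 1 * Phi_fps 3) + Phi_fps 5 + 2 * Phi_fps 3 - Phi_fps 1"
    unfolding Phi_fps_1_mult_3 by simp
  finally show ?thesis
    by (simp add: P_fps_def Q_fps_def R_fps_def algebra_simps)
qed

lemma q_deriv_E: "2 * q_deriv_fps E_fps = E_fps * P_fps - Q_fps"
proof -
  have "4 * (2 * q_deriv_fps E_fps) = 3 * (4 * q_deriv_fps P_fps) - 4 * q_deriv_fps E2_fps"
    by (simp add: E2_fps_eq q_deriv_fps_simps)
  also have "\<dots> = 4 * (E_fps * P_fps - Q_fps)"
    unfolding q_deriv_P q_deriv_E2 unfolding E2_fps_eq by (simp add: algebra_simps power2_eq_square)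
  finally show ?thesis by (subst (asm) mult_cancel_left) simp
qed

text \<open>The product rule for \<open>E_fps * Q_fps\<close>, with this product written as
  \<open>R_fps\<close> again in the result.\<close>

lemma q_deriv_R: "2 * q_deriv_fps R_fps = 3 * P_fps * R_fps - Q_fps ^ 2 - 2 * E_fps * R_fps"
proof -
  have "2 * q_deriv_fps R_fps = (2 * q_deriv_fps E_fps) * Q_fps + 2 * E_fps * q_deriv_fps Q_fps"
    by (simp add: R_fps_factor q_deriv_fps_simps algebra_simps)
  then show ?thesis
    unfolding q_deriv_E q_deriv_Q by (simp add: R_fps_factor algebra_simps power2_eq_square)
qed

subsection \<open>Isobaric polynomials\<close>

text \<open>Sums of rational multiples of monomials of weight \<open>w\<close>, where
  \<open>P_fps\<close> and \<open>E_fps\<close> have weight 2, \<open>Q_fps\<close> weight 4 and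
  \<open>R_fps\<close> weight 6. Generating them inductively gives the closure properties without
  families of coefficients, which \<open>isobaric_eval\<close> extracts at the end.\<close>

inductive isobaric :: "nat \<Rightarrow> complex fps \<Rightarrow> bool" where
  monomial: "2 * i + 2 * j + 4 * k + 6 * l = w \<Longrightarrow>
    isobaric w (fps_const (of_rat c) * P_fps ^ i * E_fps ^ j * Q_fps ^ k * R_fps ^ l)"
| add: "isobaric w F \<Longrightarrow> isobaric w G \<Longrightarrow> isobaric w (F + G)"

lemma isobaric_const: "isobaric 0 (fps_const (of_rat c))"
  using isobaric.monomial[of 0 0 0 0 0 c] by simp

lemma isobaric_gens: "isobaric 2 P_fps" "isobaric 2 E_fps" "isobaric 4 Q_fps" "isobaric 6 R_fps"
  using isobaric.monomial[of 1 0 0 0 2 1] isobaric.monomial[of 0 1 0 0 2 1]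
    isobaric.monomial[of 0 0 1 0 4 1] isobaric.monomial[of 0 0 0 1 6 1] by simp_all

lemma isobaric_mult:
  assumes "isobaric v F" "isobaric w G"
  shows "isobaric (v + w) (F * G)"
  using assms
proof (induction rule: isobaric.induct)
  case (monomial i j k l v c)
  from monomial(2) show ?case
  proof (induction rule: isobaric.induct)
    case (monomial i' j' k' l' w c')
    have "isobaric (v + w) (fps_const (of_rat (c * c')) * P_fps ^ (i + i') * E_fps ^ (j + j') *
        Q_fps ^ (k + k') * R_fps ^ (l + l'))"
      by (rule isobaric.monomial) (use monomial \<open>2 * i + 2 * j + 4 * k + 6 * l = v\<close> in simp)
    then show ?case
      by (simp add: of_rat_mult power_add mult_ac flip: fps_const_mult)
  qed (simp add: distrib_left isobaric.add)
qed (simp add: distrib_right isobaric.add)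

lemma isobaric_scale: "isobaric w F \<Longrightarrow> isobaric w (fps_const (of_rat c) * F)"
  using isobaric_mult[OF isobaric_const] by fastforce

lemma isobaric_numeral: "isobaric w F \<Longrightarrow> isobaric w (numeral n * F)"
  using isobaric_scale[of w F "numeral n"] by (simp add: numeral_fps_const)

lemma isobaric_uminus: "isobaric w F \<Longrightarrow> isobaric w (- F)"
  using isobaric_scale[of w F "- 1"] by (simp add: of_rat_minus flip: fps_const_neg)

lemma isobaric_diff: "isobaric w F \<Longrightarrow> isobaric w G \<Longrightarrow> isobaric w (F - G)"
  using isobaric.add[OF _ isobaric_uminus] by fastforce

lemma isobaric_unscale:
  assumes "isobaric w (of_nat m * F)" "m > 0"
  shows "isobaric w F"
proof -
  have "fps_const (of_rat (1 / of_nat m)) * (of_nat m * F) = F"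
    using assms(2) by (simp add: of_rat_divide flip: fps_of_nat mult.assoc)
  with isobaric_scale[OF assms(1), of "1 / of_nat m"] show ?thesis by (simp only:)
qed

text \<open>All monomials have even weight, so for odd \<open>w\<close> not even \<open>0\<close> is
  isobaric; for even \<open>w\<close> a power of \<open>P_fps\<close> with coefficient
  \<open>0\<close> serves.\<close>

lemma isobaric_0: "even w \<Longrightarrow> isobaric w 0"
  using isobaric.monomial[of "w div 2" 0 0 0 w 0] by simp

lemma isobaric_sum: "even w \<Longrightarrow> (\<And>x. x \<in> A \<Longrightarrow> isobaric w (f x)) \<Longrightarrow> isobaric w (sum f A)"
  by (induction A rule: infinite_finite_induct) (auto intro: isobaric_0 isobaric.add)

text \<open>All four generators have constant coefficient 1. This is how the coefficients of
  \<open>sech2\<close> at even orders are seen to be rational.\<close>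

lemma isobaric_nth_0: "isobaric w F \<Longrightarrow> \<exists>c. F $ 0 = of_rat c"
proof (induction rule: isobaric.induct)
  case (monomial i j k l w c)
  have "P_fps $ 0 = 1" "E_fps $ 0 = 1" "Q_fps $ 0 = 1" "R_fps $ 0 = 1"
    by (simp_all add: P_fps_def E_fps_def Q_fps_def R_fps_def Phi_fps_def sigma_hat_def)
  then show ?case by (auto simp: fps_power_zeroth)
next
  case (add w F G)
  then show ?case by (metis fps_add_nth of_rat_add)
qed

lemma isobaric_q_deriv_gens: "isobaric 4 (q_deriv_fps P_fps)" "isobaric 4 (q_deriv_fps E_fps)"
  "isobaric 6 (q_deriv_fps Q_fps)" "isobaric 8 (q_deriv_fps R_fps)"
proof -
  note g = isobaric_gens isobaric_diff isobaric_numeral isobaric_mult[of 2 _ 2, simplified]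
    isobaric_mult[of 2 _ 4, simplified] isobaric_mult[of 2 _ 6, simplified] isobaric_mult[of 4 _ 4, simplified]
  show "isobaric 4 (q_deriv_fps P_fps)"
    by (rule isobaric_unscale[of _ 4]) (simp_all add: q_deriv_P power2_eq_square g)
  show "isobaric 4 (q_deriv_fps E_fps)"
    by (rule isobaric_unscale[of _ 2]) (simp_all add: q_deriv_E g)
  show "isobaric 6 (q_deriv_fps Q_fps)"
    by (simp add: q_deriv_Q g)
  show "isobaric 8 (q_deriv_fps R_fps)"
    by (rule isobaric_unscale[of _ 2]) (simp_all add: q_deriv_R power2_eq_square mult.assoc g)
qed

lemma isobaric_q_deriv:
  assumes "isobaric w F"
  shows "isobaric (w + 2) (q_deriv_fps F)"
proof -
  \<comment> \<open>The product rule involves the factors as well as their derivatives, so both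
    properties are carried through a monomial together.\<close>
  define good where "good w F \<longleftrightarrow> isobaric w F \<and> isobaric (w + 2) (q_deriv_fps F)" for w F
  have good_mult: "good (v + w) (F * G)" if "good v F" "good w G" for v w F G
    using that isobaric_mult[of v F w G] isobaric_mult[of "v + 2" "q_deriv_fps F" w G]
      isobaric_mult[of v F "w + 2" "q_deriv_fps G"]
    by (auto simp: good_def q_deriv_fps_simps add_ac intro: isobaric.add)
  have good_const: "good 0 (fps_const (of_rat c))" for c
    by (simp add: good_def isobaric_const q_deriv_fps_simps isobaric_0)
  have good_power: "good (m * w) (F ^ m)" if "good w F" for m w F
  proof (induction m)
    case 0
    then show ?case using good_const[of 1] by simp
  qed (use good_mult that in simp)
  have good_gens: "good 2 P_fps" "good 2 E_fps" "good 4 Q_fps" "good 6 R_fps"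
    using isobaric_gens isobaric_q_deriv_gens by (simp_all add: good_def)
  show ?thesis
    using assms
  proof (induction rule: isobaric.induct)
    case (monomial i j k l w c)
    have "good (0 + i * 2 + j * 2 + k * 4 + l * 6)
        (fps_const (of_rat c) * P_fps ^ i * E_fps ^ j * Q_fps ^ k * R_fps ^ l)"
      by (intro good_mult good_const good_power good_gens)
    with monomial show ?case by (simp add: good_def mult.commute)
  qed (simp add: q_deriv_fps_simps isobaric.add)
qed

text \<open>Strong induction with \<open>u_fps_recurrence\<close>. The case \<open>k = 0\<close> of
  the recurrence contains the derivative of \<open>E2_fps\<close>, hence \<open>m = 2\<close> is a
  base case, settled by \<open>Q_fps\<close>.\<close>

lemma isobaric_u_fps: "(odd m \<longrightarrow> u_fps m = 0) \<and> (even m \<longrightarrow> isobaric (m + 2) (u_fps m))"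
proof (induction m rule: less_induct)
  case (less m)
  consider "m = 0" | "m = 1" | "m = 2" | k where "m = k + 2" "k > 0"
    by (metis One_nat_def add_2_eq_Suc' add_cancel_left_left gr0I not0_implies_Suc)
  then show ?case
  proof cases
    case 1
    then show ?thesis
      using isobaric_unscale[of 2 4 "u_fps 0"] isobaric_gens(1) by (simp add: P_fps_eq numeral_2_eq_2)
  next
    case 2
    then show ?thesis using u_fps_1 by simp
  next
    case 3
    then show ?thesis
      using isobaric_unscale[of 4 16 "u_fps 2"] isobaric_uminus[OF isobaric_gens(3)] by (simp add: Q_fps_eq)
  next
    case 4
    \<comment> \<open>The end terms \<open>i = 0\<close> and \<open>i = k\<close> contribute
      \<open>12 * u_fps 0 * u_fps k = 3 * P_fps * u_fps k\<close>, which cancels the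
      \<open>P_fps\<close> part of \<open>E2_fps\<close>.\<close>
    have "{..k} = insert 0 (insert k {1..<k})"
      using \<open>k > 0\<close> by auto
    then have "(\<Sum>i\<le>k. u_fps i * u_fps (k - i)) =
        2 * (u_fps 0 * u_fps k) + (\<Sum>i\<in>{1..<k}. u_fps i * u_fps (k - i))"
      using \<open>k > 0\<close> by simp
    with u_fps_recurrence[of k] \<open>k > 0\<close> have "of_nat ((k + 2) * (k + 1)) * u_fps m =
        E2_fps * u_fps k - 6 * (2 * (u_fps 0 * u_fps k) + (\<Sum>i\<in>{1..<k}. u_fps i * u_fps (k - i)))"
      unfolding \<open>m = k + 2\<close> eq_diff_eq by (simp only: if_not_P neq0_conv add_0_right)
    then have rec: "of_nat ((k + 2) * (k + 1)) * u_fps m =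
        - (2 * (E_fps * u_fps k)) - 6 * (\<Sum>i\<in>{1..<k}. u_fps i * u_fps (k - i))"
      by (simp add: E2_fps_eq P_fps_eq algebra_simps)
    show ?thesis
    proof (cases "even m")
      case True
      then have "even k" using \<open>m = k + 2\<close> by simp
      have "isobaric (k + 4) (u_fps i * u_fps (k - i))" if "i \<in> {1..<k}" for i
      proof (cases "even i")
        case True
        then show ?thesis
          using that less.IH[of i] less.IH[of "k - i"] \<open>even k\<close> \<open>m = k + 2\<close>
            isobaric_mult[of "i + 2" "u_fps i" "k - i + 2" "u_fps (k - i)"]
          by (simp add: eval_nat_numeral)
      next
        case False
        then show ?thesis
          using that less.IH[of i] \<open>even k\<close> \<open>m = k + 2\<close> isobaric_0[of "k + 4"] by simp
      qed
      then have "isobaric (k + 4) (\<Sum>i\<in>{1..<k}. u_fps i * u_fps (k - i))"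
        using \<open>even k\<close> by (intro isobaric_sum) auto
      moreover have "isobaric (k + 4) (E_fps * u_fps k)"
        using isobaric_mult[OF isobaric_gens(2), of "k + 2" "u_fps k"] less.IH[of k] \<open>even k\<close> \<open>m = k + 2\<close>
        by (simp add: eval_nat_numeral)
      ultimately have "isobaric (k + 4) (of_nat ((k + 2) * (k + 1)) * u_fps m)"
        unfolding rec by (intro isobaric_diff isobaric_uminus isobaric_numeral)
      then have "isobaric (k + 4) (u_fps m)"
        by (rule isobaric_unscale) simp
      with True \<open>m = k + 2\<close> show ?thesis by (simp add: eval_nat_numeral)
    next
      case False
      then have "odd k" using \<open>m = k + 2\<close> by simp
      have "u_fps i * u_fps (k - i) = 0" if "i \<in> {1..<k}" for i
        using that less.IH[of i] less.IH[of "k - i"] \<open>odd k\<close> \<open>m = k + 2\<close>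
        by (cases "even i") auto
      then have "(\<Sum>i\<in>{1..<k}. u_fps i * u_fps (k - i)) = 0"
        by (intro sum.neutral) blast
      moreover have "u_fps k = 0"
        using less.IH[of k] \<open>odd k\<close> \<open>m = k + 2\<close> by simp
      ultimately have "of_nat ((k + 2) * (k + 1)) * u_fps m = 0"
        unfolding rec by simp
      then have "u_fps m = 0"
        by (subst (asm) mult_eq_0_iff) (simp flip: of_nat_mult of_nat_Suc del: of_nat_Suc of_nat_mult)
      with False show ?thesis by simp
    qed
  qed
qed

text \<open>A multiple of \<open>u_fps (s - 1)\<close>, whose constant coefficient is rational by
  \<open>isobaric_nth_0\<close>. The constant stays, its weight being \<open>0\<close> and not
  \<open>s + 1\<close>.\<close>

lemma isobaric_Phi_fps:
  assumes "odd s"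
  shows "\<exists>c. isobaric (s + 1) (fps_const (of_rat c) + Phi_fps s)"
proof -
  obtain k where k: "s = k + 1" "even k" using assms by (metis oddE dvd_triv_left)
  have u: "isobaric (k + 2) (u_fps k)" using isobaric_u_fps k(2) by blast
  obtain c where "u_fps k $ 0 = of_rat c" using isobaric_nth_0[OF u] by blast
  then have c: "sech2 $ k = of_rat c"
    using k(2) by (simp add: u_fps_even Phi_fps_def del: u_fps_nth)
  have "of_rat (fact k) = (fact k :: complex)"
    by (metis of_nat_fact of_rat_of_nat_eq)
  then have "fps_const (of_rat (fact k / 2)) * u_fps k = fps_const (of_rat (fact k / 2 * c)) + Phi_fps s"
    unfolding u_fps_even[OF k(2)] c k(1)
    by (simp add: distrib_left of_rat_mult of_rat_divide flip: mult.assoc)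
  with isobaric_scale[OF u, of "fact k / 2"] show ?thesis using k(1) by auto
qed

lemma q_deriv_fps_funpow_nth: "(q_deriv_fps ^^ r) F $ n = of_nat n ^ r * F $ n"
  by (induction r) simp_all

text \<open>The first derivative removes the constant of \<open>isobaric_Phi_fps\<close>, and each
  one raises the weight by 2.\<close>

lemma isobaric_q_deriv_Phi_fps:
  assumes "odd s" "r > 0"
  shows "isobaric (s + 1 + 2 * r) ((q_deriv_fps ^^ r) (Phi_fps s))"
proof -
  obtain c where c: "isobaric (s + 1) (fps_const (of_rat c) + Phi_fps s)"
    using isobaric_Phi_fps[OF assms(1)] by blast
  have "isobaric (s + 1 + 2 * r) ((q_deriv_fps ^^ r) (fps_const (of_rat c) + Phi_fps s))"
  proof (induction r)
    case (Suc r)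
    then show ?case using isobaric_q_deriv by fastforce
  qed (use c in simp)
  moreover have "(q_deriv_fps ^^ r) (fps_const (of_rat c) + Phi_fps s) = (q_deriv_fps ^^ r) (Phi_fps s)"
    using assms(2) by (simp add: fps_eq_iff q_deriv_fps_funpow_nth)
  ultimately show ?thesis by simp
qed

section \<open>Convergence in the unit disc and evaluation\<close>

definition conv1 :: "complex fps \<Rightarrow> bool" where
  "conv1 F \<longleftrightarrow> fps_conv_radius F \<ge> 1"

lemma conv1_intros [simp]:
  "conv1 (fps_const c)" "conv1 1" "conv1 (numeral k)"
  "conv1 F \<Longrightarrow> conv1 G \<Longrightarrow> conv1 (F + G)"
  "conv1 F \<Longrightarrow> conv1 G \<Longrightarrow> conv1 (F - G)"
  "conv1 F \<Longrightarrow> conv1 (- F)"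
  "conv1 F \<Longrightarrow> conv1 G \<Longrightarrow> conv1 (F * G)"
  "conv1 F \<Longrightarrow> conv1 (F ^ m)"
  "conv1 F \<Longrightarrow> conv1 (q_deriv_fps F)"
  using fps_conv_radius_add[of F G] fps_conv_radius_diff[of F G] fps_conv_radius_mult[of F G]
    fps_conv_radius_power[of F m] fps_conv_radius_mult[of fps_X "fps_deriv F"] fps_conv_radius_deriv[of F]
  by (auto simp: conv1_def q_deriv_fps_def min_def split: if_splits intro: order_trans)

lemma eval_fps_conv1 [simp]:
  assumes "norm q < 1"
  shows "conv1 F \<Longrightarrow> conv1 G \<Longrightarrow> eval_fps (F + G) q = eval_fps F q + eval_fps G q"
    and "conv1 F \<Longrightarrow> conv1 G \<Longrightarrow> eval_fps (F - G) q = eval_fps F q - eval_fps G q"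
    and "conv1 F \<Longrightarrow> conv1 G \<Longrightarrow> eval_fps (F * G) q = eval_fps F q * eval_fps G q"
    and "conv1 F \<Longrightarrow> eval_fps (- F) q = - eval_fps F q"
    and "conv1 F \<Longrightarrow> eval_fps (F ^ m) q = eval_fps F q ^ m"
proof -
  have *: "ereal (norm q) < fps_conv_radius F" if "conv1 F" for F
    using that assms unfolding conv1_def by (metis ereal_less(3) order_less_le_trans)
  show "conv1 F \<Longrightarrow> conv1 G \<Longrightarrow> eval_fps (F + G) q = eval_fps F q + eval_fps G q"
    and "conv1 F \<Longrightarrow> conv1 G \<Longrightarrow> eval_fps (F - G) q = eval_fps F q - eval_fps G q"
    and "conv1 F \<Longrightarrow> conv1 G \<Longrightarrow> eval_fps (F * G) q = eval_fps F q * eval_fps G q"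
    and "conv1 F \<Longrightarrow> eval_fps (- F) q = - eval_fps F q"
    and "conv1 F \<Longrightarrow> eval_fps (F ^ m) q = eval_fps F q ^ m"
    by (simp_all add: * eval_fps_add eval_fps_diff eval_fps_mult eval_fps_minus eval_fps_power)
qed

lemma conv1_poly_bound:
  assumes "\<And>n. n > 0 \<Longrightarrow> norm (F $ n) \<le> real n ^ m"
  shows "conv1 F"
  unfolding conv1_def fps_conv_radius_def
proof (rule conv_radius_geI_ex)
  fix r :: real assume "0 < r" "ereal r < 1"
  then show "\<exists>z. norm z = r \<and> summable (\<lambda>n. F $ n * z ^ n)"
    using summable_of_poly_bound[of "of_real r", OF _ assms] by (intro exI[of _ "of_real r"]) auto
qed

lemma Phi_fps_nth: "n > 0 \<Longrightarrow> Phi_fps s $ n = sigma_tilde s n"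
  by (simp add: Phi_fps_def lambert_nth sigma_tilde_def)

lemma conv1_generators [simp]: "conv1 (Phi_fps s)" "conv1 P_fps" "conv1 E_fps" "conv1 Q_fps" "conv1 R_fps"
proof -
  show Phi: "conv1 (Phi_fps s)" for s
    by (rule conv1_poly_bound[of _ "Suc s"]) (metis Phi_fps_nth norm_sigma_tilde_le)
  have "conv1 (Abs_fps sigma_hat)"
    by (rule conv1_poly_bound[of _ 2]) (simp add: norm_sigma_hat_le)
  then have "conv1 (24 * Abs_fps sigma_hat)" by simp
  also have "24 * Abs_fps sigma_hat = E_fps" by (simp add: fps_eq_iff E_fps_def)
  finally show "conv1 E_fps" .
  show "conv1 P_fps" "conv1 Q_fps" "conv1 R_fps"
    using Phi by (simp_all add: P_fps_def Q_fps_def R_fps_def)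
qed

lemma eval_fps_gens:
  "eval_fps P_fps q = P_fun q" "eval_fps E_fps q = E_fun q"
  "eval_fps Q_fps q = Q_fun q" "eval_fps R_fps q = R_fun q"
proof -
  have "P_fps $ n = 8 * sigma_tilde 1 n" "Q_fps $ n = - 16 * sigma_tilde 3 n"
    "R_fps $ n = 8 * sigma_tilde 5 n" for n
    by (cases "n = 0";
        simp add: P_fps_def Q_fps_def R_fps_def Phi_fps_nth fps_numeral_nth;
        simp add: sigma_tilde_def Phi_fps_def)+
  then show "eval_fps P_fps q = P_fun q" "eval_fps E_fps q = E_fun q"
    "eval_fps Q_fps q = Q_fun q" "eval_fps R_fps q = R_fun q"
    by (simp_all add: eval_fps_def P_fun_def Q_fun_def R_fun_def E_fun_def E_fps_def)
qed

lemma eval_fps_Phi: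
  assumes "norm q < 1"
  shows "eval_fps ((q_deriv_fps ^^ r) (Phi_fps (s - r))) q = Phi_tilde r s q"
proof -
  have "(\<lambda>n. (q_deriv_fps ^^ r) (Phi_fps (s - r)) $ Suc n * q ^ Suc n) sums Phi_tilde r s q"
    using Phi_tilde_sums[OF assms, of r s] by (simp only: q_deriv_fps_funpow_nth Phi_fps_nth[OF zero_less_Suc])
  \<comment> \<open>Starting at \<open>n = 0\<close> adds nothing, since \<open>Phi_fps\<close> has
    constant coefficient \<open>0\<close>.\<close>
  then have "(\<lambda>n. (q_deriv_fps ^^ r) (Phi_fps (s - r)) $ n * q ^ n) sums Phi_tilde r s q"
    by (subst (asm) sums_Suc_iff) (simp add: q_deriv_fps_funpow_nth Phi_fps_def)
  then show ?thesis by (simp add: eval_fps_def sums_iff)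
qed

lemma finite_exponents: "finite {(i, j, k, l). 2 * i + 2 * j + 4 * k + 6 * l = (w :: nat)}"
  by (rule finite_subset[of _ "{..w} \<times> {..w} \<times> {..w} \<times> {..w}"]) auto

lemma isobaric_eval:
  assumes "isobaric w F"
  shows "\<exists>K :: nat \<Rightarrow> nat \<Rightarrow> nat \<Rightarrow> nat \<Rightarrow> rat. \<forall>q. norm q < 1 \<longrightarrow> eval_fps F q =
    (\<Sum>(i, j, k, l) \<in> {(i, j, k, l). 2 * i + 2 * j + 4 * k + 6 * l = w}.
      of_rat (K i j k l) * P_fun q ^ i * E_fun q ^ j * Q_fun q ^ k * R_fun q ^ l)"
proof -
  \<comment> \<open>Convergence is carried along because splitting \<open>eval_fps (F + G)\<close>
    uses it for both summands.\<close>
  have "conv1 F \<and> ?thesis"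
    using assms
  proof (induction rule: isobaric.induct)
    case (monomial i j k l w c)
    let ?K = "\<lambda>i' j' k' l'. if (i', j', k', l') = (i, j, k, l) then c else 0"
    have "eval_fps (fps_const (of_rat c) * P_fps ^ i * E_fps ^ j * Q_fps ^ k * R_fps ^ l) q =
      (\<Sum>(i, j, k, l) \<in> {(i, j, k, l). 2 * i + 2 * j + 4 * k + 6 * l = w}.
        of_rat (?K i j k l) * P_fun q ^ i * E_fun q ^ j * Q_fun q ^ k * R_fun q ^ l)"
      if "norm q < 1" for q
    proof -
      have "(\<Sum>(i, j, k, l) \<in> {(i, j, k, l). 2 * i + 2 * j + 4 * k + 6 * l = w}.
          of_rat (?K i j k l) * P_fun q ^ i * E_fun q ^ j * Q_fun q ^ k * R_fun q ^ l) =
        (\<Sum>x \<in> {(i, j, k, l). 2 * i + 2 * j + 4 * k + 6 * l = w}. if x = (i, j, k, l) then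
          of_rat c * P_fun q ^ i * E_fun q ^ j * Q_fun q ^ k * R_fun q ^ l else 0)"
        by (intro sum.cong) (auto split: if_splits)
      also have "\<dots> = of_rat c * P_fun q ^ i * E_fun q ^ j * Q_fun q ^ k * R_fun q ^ l"
        using monomial by (subst sum.delta[OF finite_exponents]) simp
      finally show ?thesis using that by (simp add: eval_fps_gens)
    qed
    then show ?case by (intro conjI exI[of _ ?K]) simp_all
  next
    case (add w F G)
    from add.IH(1) obtain K :: "nat \<Rightarrow> nat \<Rightarrow> nat \<Rightarrow> nat \<Rightarrow> rat" where K:
      "conv1 F" "\<forall>q. norm q < 1 \<longrightarrow> eval_fps F q =
        (\<Sum>(i, j, k, l) \<in> {(i, j, k, l). 2 * i + 2 * j + 4 * k + 6 * l = w}.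
          of_rat (K i j k l) * P_fun q ^ i * E_fun q ^ j * Q_fun q ^ k * R_fun q ^ l)"
      by blast
    from add.IH(2) obtain L :: "nat \<Rightarrow> nat \<Rightarrow> nat \<Rightarrow> nat \<Rightarrow> rat" where L:
      "conv1 G" "\<forall>q. norm q < 1 \<longrightarrow> eval_fps G q =
        (\<Sum>(i, j, k, l) \<in> {(i, j, k, l). 2 * i + 2 * j + 4 * k + 6 * l = w}.
          of_rat (L i j k l) * P_fun q ^ i * E_fun q ^ j * Q_fun q ^ k * R_fun q ^ l)"
      by blast
    have "eval_fps (F + G) q =
        (\<Sum>(i, j, k, l) \<in> {(i, j, k, l). 2 * i + 2 * j + 4 * k + 6 * l = w}.
        of_rat (K i j k l + L i j k l) * P_fun q ^ i * E_fun q ^ j * Q_fun q ^ k * R_fun q ^ l)"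
      if "norm q < 1" for q
      using that K L by (simp add: of_rat_add distrib_right sum.distrib case_prod_beta)
    with K(1) L(1) show ?case
      by (intro conjI exI[of _ "\<lambda>i j k l. K i j k l + L i j k l"]) simp_all
  qed
  then show ?thesis ..
qed

section \<open>The six identities and the general representation\<close>

lemma Phi_fps_identities:
  "32 * q_deriv_fps (Phi_fps 1) = P_fps ^ 2 - Q_fps"
  "16 * q_deriv_fps (Phi_fps 3) = - P_fps * Q_fps + R_fps"
  "16 * q_deriv_fps (Phi_fps 5) = 3 * P_fps * R_fps - Q_fps ^ 2 - 2 * E_fps * R_fps"
  "64 * q_deriv_fps (q_deriv_fps (Phi_fps 1)) = P_fps ^ 3 - 3 * P_fps * Q_fps + 2 * R_fps"
  "64 * q_deriv_fps (q_deriv_fps (Phi_fps 3)) =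
    - 5 * P_fps ^ 2 * Q_fps - Q_fps ^ 2 + 10 * P_fps * R_fps - 4 * E_fps * R_fps"
  "64 * q_deriv_fps (q_deriv_fps (Phi_fps 5)) =
    21 * P_fps ^ 2 * R_fps + 13 * Q_fps * R_fps - 14 * P_fps * Q_fps ^ 2
      - 28 * P_fps * E_fps * R_fps + 8 * E_fps ^ 2 * R_fps"
proof -
  note D = q_deriv_fps_simps power2_eq_square
  show 1: "32 * q_deriv_fps (Phi_fps 1) = P_fps ^ 2 - Q_fps"
    using q_deriv_P by (simp add: P_fps_def q_deriv_fps_simps)
  show 2: "16 * q_deriv_fps (Phi_fps 3) = - P_fps * Q_fps + R_fps"
    using q_deriv_Q by (simp add: Q_fps_def q_deriv_fps_simps algebra_simps)
  show 3: "16 * q_deriv_fps (Phi_fps 5) = 3 * P_fps * R_fps - Q_fps ^ 2 - 2 * E_fps * R_fps"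
    using q_deriv_R by (simp add: R_fps_def q_deriv_fps_simps)
  have 4: "32 * q_deriv_fps (q_deriv_fps (Phi_fps 1)) = q_deriv_fps (P_fps ^ 2 - Q_fps)"
    unfolding 1[symmetric] by (simp add: q_deriv_fps_simps)
  show "64 * q_deriv_fps (q_deriv_fps (Phi_fps 1)) = P_fps ^ 3 - 3 * P_fps * Q_fps + 2 * R_fps"
    using 4 q_deriv_P q_deriv_Q unfolding D by algebra
  have 5: "16 * q_deriv_fps (q_deriv_fps (Phi_fps 3)) = q_deriv_fps (- P_fps * Q_fps + R_fps)"
    unfolding 2[symmetric] by (simp add: q_deriv_fps_simps)
  show "64 * q_deriv_fps (q_deriv_fps (Phi_fps 3)) =
      - 5 * P_fps ^ 2 * Q_fps - Q_fps ^ 2 + 10 * P_fps * R_fps - 4 * E_fps * R_fps"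
    using 5 q_deriv_P q_deriv_Q q_deriv_R unfolding D by algebra
  have 6: "16 * q_deriv_fps (q_deriv_fps (Phi_fps 5)) =
      q_deriv_fps (3 * P_fps * R_fps - Q_fps ^ 2 - 2 * E_fps * R_fps)"
    unfolding 3[symmetric] by (simp add: q_deriv_fps_simps)
  show "64 * q_deriv_fps (q_deriv_fps (Phi_fps 5)) =
      21 * P_fps ^ 2 * R_fps + 13 * Q_fps * R_fps - 14 * P_fps * Q_fps ^ 2
        - 28 * P_fps * E_fps * R_fps + 8 * E_fps ^ 2 * R_fps"
    \<comment> \<open>Differentiation produces \<open>9 Q R + 4 E Q ^ 2\<close>, and
      \<open>R = E Q\<close> merges these into \<open>13 Q R\<close>.\<close>
    using 6 q_deriv_P q_deriv_Q q_deriv_E q_deriv_R R_fps_factor unfolding D by algebra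
qed

text \<open>For \<open>r = 0\<close> a rational constant has to be allowed. Indeed
  \<open>Phi_tilde 0 1\<close> is \<open>(P - 1) / 8\<close>, with expansion
  \<open>q - q^2 + ...\<close>, whereas the combinations of \<open>P_fun\<close> and
  \<open>E_fun\<close> without constant term are the multiples of \<open>q + 2 q^2 + ...\<close>.
  For \<open>r \<ge> 1\<close> the derivative removes the constant.\<close>

theorem theorem2p17:
  shows
    "(\<forall>q::complex. norm q < 1 \<longrightarrow>
        32 * Phi_tilde 1 2 q = P_fun q ^ 2 - Q_fun q \<and>
        16 * Phi_tilde 1 4 q = - P_fun q * Q_fun q + R_fun q \<and>
        16 * Phi_tilde 1 6 q = 3 * P_fun q * R_fun q - Q_fun q ^ 2 - 2 * E_fun q * R_fun q \<and>
        64 * Phi_tilde 2 3 q = P_fun q ^ 3 - 3 * P_fun q * Q_fun q + 2 * R_fun q \<and>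
        64 * Phi_tilde 2 5 q =
          - 5 * P_fun q ^ 2 * Q_fun q - Q_fun q ^ 2 + 10 * P_fun q * R_fun q
            - 4 * E_fun q * R_fun q \<and>
        64 * Phi_tilde 2 7 q =
          21 * P_fun q ^ 2 * R_fun q + 13 * Q_fun q * R_fun q - 14 * P_fun q * Q_fun q ^ 2
            - 28 * P_fun q * E_fun q * R_fun q + 8 * E_fun q ^ 2 * R_fun q) \<and>
     (\<forall>r s::nat. 1 \<le> r \<and> r \<le> s \<and> odd (r + s) \<longrightarrow>
        (\<exists>K :: nat \<Rightarrow> nat \<Rightarrow> nat \<Rightarrow> nat \<Rightarrow> rat. \<forall>q::complex. norm q < 1 \<longrightarrow>
           Phi_tilde r s q =
             (\<Sum>(i, j, k, l) \<in> {(i, j, k, l). 2 * i + 2 * j + 4 * k + 6 * l = r + s + 1}.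
                of_rat (K i j k l) *
                  P_fun q ^ i * E_fun q ^ j * Q_fun q ^ k * R_fun q ^ l))) \<and>
     (\<forall>s::nat. odd s \<longrightarrow>
        (\<exists>(c :: rat) (K :: nat \<Rightarrow> nat \<Rightarrow> nat \<Rightarrow> nat \<Rightarrow> rat). \<forall>q::complex. norm q < 1 \<longrightarrow>
           of_rat c + Phi_tilde 0 s q =
             (\<Sum>(i, j, k, l) \<in> {(i, j, k, l). 2 * i + 2 * j + 4 * k + 6 * l = s + 1}.
                of_rat (K i j k l) *
                  P_fun q ^ i * E_fun q ^ j * Q_fun q ^ k * R_fun q ^ l)))"
proof (intro conjI allI impI, goal_cases)
  case (1 q)
  then show ?case
    using arg_cong[OF Phi_fps_identities(1), of "\<lambda>F. eval_fps F q"] eval_fps_Phi[of q 1 2]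
    by (simp add: eval_fps_gens)
next
  case (2 q)
  then show ?case
    using arg_cong[OF Phi_fps_identities(2), of "\<lambda>F. eval_fps F q"] eval_fps_Phi[of q 1 4]
    by (simp add: eval_fps_gens)
next
  case (3 q)
  then show ?case
    using arg_cong[OF Phi_fps_identities(3), of "\<lambda>F. eval_fps F q"] eval_fps_Phi[of q 1 6]
    by (simp add: eval_fps_gens)
next
  case (4 q)
  then show ?case
    using arg_cong[OF Phi_fps_identities(4), of "\<lambda>F. eval_fps F q"] eval_fps_Phi[of q 2 3]
    by (simp add: eval_fps_gens numeral_2_eq_2)
next
  case (5 q)
  then show ?case
    using arg_cong[OF Phi_fps_identities(5), of "\<lambda>F. eval_fps F q"] eval_fps_Phi[of q 2 5]
    by (simp add: eval_fps_gens numeral_2_eq_2)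
next
  case (6 q)
  then show ?case
    using arg_cong[OF Phi_fps_identities(6), of "\<lambda>F. eval_fps F q"] eval_fps_Phi[of q 2 7]
    by (simp add: eval_fps_gens numeral_2_eq_2)
next
  case (7 r s)
  then have "isobaric (s - r + 1 + 2 * r) ((q_deriv_fps ^^ r) (Phi_fps (s - r)))"
    by (intro isobaric_q_deriv_Phi_fps) auto
  also have "s - r + 1 + 2 * r = r + s + 1"
    using 7 by simp
  finally obtain K :: "nat \<Rightarrow> nat \<Rightarrow> nat \<Rightarrow> nat \<Rightarrow> rat" where
    "\<forall>q. norm q < 1 \<longrightarrow> eval_fps ((q_deriv_fps ^^ r) (Phi_fps (s - r))) q =
      (\<Sum>(i, j, k, l) \<in> {(i, j, k, l). 2 * i + 2 * j + 4 * k + 6 * l = r + s + 1}.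
        of_rat (K i j k l) * P_fun q ^ i * E_fun q ^ j * Q_fun q ^ k * R_fun q ^ l)"
    using isobaric_eval by blast
  then show ?case
    by (intro exI[of _ K]) (simp add: eval_fps_Phi)
next
  case (8 s)
  then obtain c where "isobaric (s + 1) (fps_const (of_rat c) + Phi_fps s)"
    using isobaric_Phi_fps by blast
  then obtain K :: "nat \<Rightarrow> nat \<Rightarrow> nat \<Rightarrow> nat \<Rightarrow> rat" where
    "\<forall>q. norm q < 1 \<longrightarrow> eval_fps (fps_const (of_rat c) + Phi_fps s) q =
      (\<Sum>(i, j, k, l) \<in> {(i, j, k, l). 2 * i + 2 * j + 4 * k + 6 * l = s + 1}.
        of_rat (K i j k l) * P_fun q ^ i * E_fun q ^ j * Q_fun q ^ k * R_fun q ^ l)"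
    using isobaric_eval by blast
  moreover have "eval_fps (fps_const (of_rat c) + Phi_fps s) q = of_rat c + Phi_tilde 0 s q"
    if "norm q < 1" for q
    using that eval_fps_Phi[of q 0 s] by simp
  ultimately show ?case
    by (intro exI[of _ c] exI[of _ K]) simp
qed

end
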